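(* Let $M$ be a complete (connected) $n$-dimensional Riemannian manifold with metric $g$ and distance function $\rho$, let $x^*\in M$, and let $D\subseteq B_{x^*}(i(x^* ))$ be an open set containing $x^*$. Let $f:[0,+\infty)\times D\to TM$, with $f(t,x)\in T_xM$, be continuous in $t$ and locally Lipschitz in $x$, and suppose that $x^*$ is an equilibrium point of the system $$\dot x(t)=f(t,x(t)),\qquad t\ge t_0\ge 0, \qquad (\mathrm{S})$$ i.e. $f(t,x^* )=0$ for all $t\ge 0$. Let $r_0=\sup\{r>0:\ B_{x^*}(r)\subseteq D\}\in(0,+\infty]$. Suppose there exist a continuously differentiable function $V:[0,+\infty)\times D\to\mathbb R$ and positive constants $k_1,k_2,k_3,a$ such that for all $(t,x)\in[0,+\infty)\times D$ $$k_1\rho^a(x^*,x)\le V(t,x)\le k_2\rho^a(x^*,x),$$ $$V_t(t,x)+d_xV(t,x)(f(t,x))\le -k_3\rho^a(x^*,x).$$ Then $x^*$ is exponentially stable in $B_{x^*}\bigl((k_1/k_2)^{1/a}r_0\bigr)$, and the solutions $x(\cdot)$ of (S) satisfy $$\rho(x(t),x^* )\le\left(\frac{k_2}{k_1}\right)^{1/a}\rho(x(t_0),x^* )\,e^{-\frac{k_3}{ak_2}(t-t_0)},\qquad \forall\, t\ge t_0\ge0,\quad \forall\, x(t_0)\in B_{x^*}\Bigl(\Bigl(\frac{k_1}{k_2}\Bigr)^{1/a}r_0\Bigr).$$ Here, when $r_0=+\infty$, $B_{x^*}\bigl((k_1/k_2)^{1/a}r_0\bigr)$ denotes the whole manifold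 $M$.
   Context: For $x\in M$, $T_xM$ is the tangent space with norm $|\cdot|$ given by $g$, $TM$ is the tangent bundle, $\exp_x:T_xM\to M$ is the exponential map of the Levi-Civita connection, and $\rho(\cdot,\cdot)$ is the Riemannian distance on $M$. For $r>0$, $B(O_x,r)=\{X\in T_xM:\ |X|<r\}$ and $B_x(r)=\{y\in M:\ \rho(x,y)<r\}$; $B_x(+\infty)$ means $M$. The injectivity radius $i(x)\in(0,+\infty]$ is the largest $r$ for which $\exp_x:B(O_x,r)\to B_x(r)$ is a diffeomorphism. $V_t(t,x)$ denotes the partial derivative of $V$ in $t$, and $d_xV(t,x)$ the partial differential of $V$ in $x$ (a linear functional on $T_xM$). The equilibrium point $x^*$ is exponentially stable in a subset $\widetilde D\subseteq D$ if there exist positive constants $k,\lambda$, independent of $t_0$, such that the solution $x(\cdot)$ of (S) satisfies $\rho(x^*,x(t))\le k\,\rho(x^*,x(t_0))\,e^{-\lambda(t-t_0)}$ for all $t\ge t_0\ge0$ and all $x(t_0)\in\widetilde D$. "Locally Lipschitz in $x$" is understood in local coordinates, in the usual sense of ODE theory (locally in $x$, with a Lipschitz constant uniform for $t$ in compact intervals). *)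

theory Defs
  imports "HOL-Analysis.Analysis"
begin

section \<open>Smooth manifolds\<close>

text \<open>Smoothness of maps between normed spaces; \<open>S\<close> is always an open set below.\<close>

primrec Ck_on :: "nat \<Rightarrow> 'a::real_normed_vector set \<Rightarrow> ('a \<Rightarrow> 'b::real_normed_vector) \<Rightarrow> bool" where
  "Ck_on 0 S h \<longleftrightarrow> continuous_on S h"
| "Ck_on (Suc k) S h \<longleftrightarrow>
     h differentiable_on S \<and> (\<forall>v. Ck_on k S (\<lambda>x. frechet_derivative h (at x) v))"

definition smooth_on :: "'a::real_normed_vector set \<Rightarrow> ('a \<Rightarrow> 'b::real_normed_vector) \<Rightarrow> bool" where
  "smooth_on S h \<longleftrightarrow> (\<forall>k. Ck_on k S h)"

text \<open>A chart is a domain together with a coordinate map, whose values outside the domain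
  are irrelevant.\<close>

type_synonym ('m, 'n) chart = "'m set \<times> ('m \<Rightarrow> real^'n)"

abbreviation cdom :: "('m, 'n::finite) chart \<Rightarrow> 'm set" where
  "cdom c \<equiv> fst c"

abbreviation coord :: "('m, 'n::finite) chart \<Rightarrow> 'm \<Rightarrow> real^'n" where
  "coord c \<equiv> snd c"

definition coord_inv :: "('m, 'n::finite) chart \<Rightarrow> real^'n \<Rightarrow> 'm" where
  "coord_inv c = inv_into (cdom c) (coord c)"

definition is_chart :: "('m::topological_space, 'n::finite) chart \<Rightarrow> bool" where
  "is_chart c \<longleftrightarrow> open (cdom c) \<and> open (coord c ` cdom c) \<and>
     homeomorphism (cdom c) (coord c ` cdom c) (coord c) (coord_inv c)"

text \<open>The manifold is the whole type \<open>'m\<close> (Hausdorff and second countable), its dimension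
  is \<open>CARD('n)\<close>. The atlas need not be maximal: none of the notions below changes when
  further compatible charts are added.\<close>

definition smooth_atlas ::
  "('m::{t2_space, second_countable_topology}, 'n::finite) chart set \<Rightarrow> bool" where
  "smooth_atlas A \<longleftrightarrow>
     (\<forall>c\<in>A. is_chart c) \<and> (\<Union>c\<in>A. cdom c) = UNIV \<and>
     (\<forall>c\<in>A. \<forall>d\<in>A. smooth_on (coord c ` (cdom c \<inter> cdom d)) (coord d \<circ> coord_inv c))"

definition charts_at :: "('m, 'n::finite) chart set \<Rightarrow> 'm \<Rightarrow> ('m, 'n) chart set" where
  "charts_at A x = {c\<in>A. x \<in> cdom c}"

section \<open>Tangent vectors\<close>

text \<open>A tangent vector at \<open>x\<close> is the family of its coordinate representations in all charts
  at \<open>x\<close>, transforming by the derivatives of the transition maps. The value at charts not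
  containing \<open>x\<close> is fixed to be \<open>0\<close>, so that equality is equality of tangent vectors;
  the vector space operations are pointwise.\<close>

type_synonym ('m, 'n) tvec = "('m, 'n) chart \<Rightarrow> real^'n"

definition transition_deriv ::
  "('m, 'n::finite) chart \<Rightarrow> ('m, 'n) chart \<Rightarrow> 'm \<Rightarrow> real^'n \<Rightarrow> real^'n" where
  "transition_deriv c d x = frechet_derivative (coord d \<circ> coord_inv c) (at (coord c x))"

definition tangent_space :: "('m, 'n::finite) chart set \<Rightarrow> 'm \<Rightarrow> ('m, 'n) tvec set" where
  "tangent_space A x = {v.
     (\<forall>c\<in>charts_at A x. \<forall>d\<in>charts_at A x. v d = transition_deriv c d x (v c)) \<and>
     (\<forall>c. c \<notin> charts_at A x \<longrightarrow> v c = 0)}"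

text \<open>The tangent vector at \<open>x\<close> whose coordinates in the chart \<open>c\<close> are \<open>u\<close>.\<close>

definition tangent_of ::
  "('m, 'n::finite) chart set \<Rightarrow> ('m, 'n) chart \<Rightarrow> 'm \<Rightarrow> real^'n \<Rightarrow> ('m, 'n) tvec" where
  "tangent_of A c x u = (\<lambda>d. if d \<in> charts_at A x then transition_deriv c d x u else 0)"

text \<open>\<open>v\<close> is the velocity at time \<open>t\<close> of a curve defined on \<open>I\<close> and continuous there
  (one-sided at end points of \<open>I\<close>).\<close>

definition has_velocity ::
  "('m, 'n::finite) chart set \<Rightarrow> (real \<Rightarrow> 'm) \<Rightarrow> ('m, 'n) tvec \<Rightarrow> real \<Rightarrow> real set \<Rightarrow> bool" where
  "has_velocity A \<gamma> v t I \<longleftrightarrow> v \<in> tangent_space A (\<gamma> t) \<and>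
     (\<forall>c\<in>charts_at A (\<gamma> t). ((coord c \<circ> \<gamma>) has_vector_derivative v c) (at t within I))"

definition velocity ::
  "('m, 'n::finite) chart set \<Rightarrow> (real \<Rightarrow> 'm) \<Rightarrow> real set \<Rightarrow> real \<Rightarrow> ('m, 'n) tvec" where
  "velocity A \<gamma> I t = (\<lambda>c. if c \<in> charts_at A (\<gamma> t)
     then vector_derivative (coord c \<circ> \<gamma>) (at t within I) else 0)"

text \<open>The differential at \<open>x\<close> of a real function, applied to a tangent vector; by the chain
  rule the choice of the chart at \<open>x\<close> does not matter.\<close>

definition differential ::
  "('m, 'n::finite) chart set \<Rightarrow> ('m \<Rightarrow> real) \<Rightarrow> 'm \<Rightarrow> ('m, 'n) tvec \<Rightarrow> real" where
  "differential A h x v = (let c = (SOME c. c \<in> charts_at A x) in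
     frechet_derivative (h \<circ> coord_inv c) (at (coord c x)) (v c))"

section \<open>Riemannian metrics\<close>

type_synonym ('m, 'n) metric_tensor = "'m \<Rightarrow> ('m, 'n) tvec \<Rightarrow> ('m, 'n) tvec \<Rightarrow> real"

text \<open>The Gram matrix \<open>g\<^sub>i\<^sub>j\<close> of the coordinate vector fields, as a function of the
  coordinates.\<close>

definition metric_matrix :: "('m, 'n::finite) chart set \<Rightarrow> ('m, 'n) metric_tensor \<Rightarrow>
    ('m, 'n) chart \<Rightarrow> real^'n \<Rightarrow> real^'n^'n" where
  "metric_matrix A g c y = (let p = coord_inv c y in
     \<chi> i j. g p (tangent_of A c p (axis i 1)) (tangent_of A c p (axis j 1)))"

definition riemannian_metric ::
  "('m, 'n::finite) chart set \<Rightarrow> ('m, 'n) metric_tensor \<Rightarrow> bool" where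
  "riemannian_metric A g \<longleftrightarrow>
     (\<forall>x. \<forall>u\<in>tangent_space A x. \<forall>v\<in>tangent_space A x. \<forall>w\<in>tangent_space A x. \<forall>a b.
        g x (\<lambda>c. a *\<^sub>R u c + b *\<^sub>R v c) w = a * g x u w + b * g x v w) \<and>
     (\<forall>x. \<forall>u\<in>tangent_space A x. \<forall>v\<in>tangent_space A x. g x u v = g x v u) \<and>
     (\<forall>x. \<forall>u\<in>tangent_space A x. u \<noteq> (\<lambda>c. 0) \<longrightarrow> g x u u > 0) \<and>
     (\<forall>c\<in>A. \<forall>i j. smooth_on (coord c ` cdom c) (\<lambda>y. metric_matrix A g c y $ i $ j))"

definition tnorm :: "('m, 'n::finite) metric_tensor \<Rightarrow> 'm \<Rightarrow> ('m, 'n) tvec \<Rightarrow> real" where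
  "tnorm g x v = sqrt (g x v v)"

definition C1_curve_on :: "('m::topological_space, 'n::finite) chart set \<Rightarrow>
    (real \<Rightarrow> 'm) \<Rightarrow> real set \<Rightarrow> bool" where
  "C1_curve_on A \<gamma> I \<longleftrightarrow> continuous_on I \<gamma> \<and>
     (\<exists>W. (\<forall>t\<in>I. has_velocity A \<gamma> (W t) t I) \<and>
          (\<forall>c\<in>A. continuous_on {t\<in>I. \<gamma> t \<in> cdom c} (\<lambda>t. W t c)))"

text \<open>Piecewise \<open>C\<^sup>1\<close>, i.e. \<open>C\<^sup>1\<close> (one-sidedly at the end points) on each closed interval of a
  finite partition.\<close>

definition piecewise_C1_curve :: "('m::topological_space, 'n::finite) chart set \<Rightarrow>
    (real \<Rightarrow> 'm) \<Rightarrow> bool" where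
  "piecewise_C1_curve A \<gamma> \<longleftrightarrow> continuous_on {0..1} \<gamma> \<and>
     (\<exists>P. finite P \<and> (\<forall>a b. 0 \<le> a \<and> a < b \<and> b \<le> 1 \<and> {a<..<b} \<inter> P = {} \<longrightarrow>
        C1_curve_on A \<gamma> {a..b}))"

definition curve_length :: "('m, 'n::finite) chart set \<Rightarrow> ('m, 'n) metric_tensor \<Rightarrow>
    (real \<Rightarrow> 'm) \<Rightarrow> real" where
  "curve_length A g \<gamma> = integral {0..1} (\<lambda>t. tnorm g (\<gamma> t) (velocity A \<gamma> {0..1} t))"

definition rdist :: "('m::topological_space, 'n::finite) chart set \<Rightarrow>
    ('m, 'n) metric_tensor \<Rightarrow> 'm \<Rightarrow> 'm \<Rightarrow> real" where
  "rdist A g x y = Inf {curve_length A g \<gamma> | \<gamma>. piecewise_C1_curve A \<gamma> \<and> \<gamma> 0 = x \<and> \<gamma> 1 = y}"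

text \<open>Balls with extended real radius, so that \<open>rball A g x \<infinity>\<close> is the whole manifold and
  \<open>tball A g x \<infinity>\<close> the whole tangent space.\<close>

definition rball :: "('m::topological_space, 'n::finite) chart set \<Rightarrow>
    ('m, 'n) metric_tensor \<Rightarrow> 'm \<Rightarrow> ereal \<Rightarrow> 'm set" where
  "rball A g x r = {y. ereal (rdist A g x y) < r}"

definition tball :: "('m, 'n::finite) chart set \<Rightarrow>
    ('m, 'n) metric_tensor \<Rightarrow> 'm \<Rightarrow> ereal \<Rightarrow> ('m, 'n) tvec set" where
  "tball A g x r = {v \<in> tangent_space A x. ereal (tnorm g x v) < r}"

definition complete_riemannian_manifold ::
  "('m::{t2_space, second_countable_topology}, 'n::finite) chart set \<Rightarrow>
    ('m, 'n) metric_tensor \<Rightarrow> bool" where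
  "complete_riemannian_manifold A g \<longleftrightarrow> smooth_atlas A \<and> riemannian_metric A g \<and>
     connected (UNIV :: 'm set) \<and> Metric_space.mcomplete UNIV (rdist A g)"

section \<open>Levi-Civita connection, exponential map and injectivity radius\<close>

text \<open>\<open>\<Gamma>\<^sup>k\<^sub>i\<^sub>j = (1/2) \<Sum>\<^sub>l g\<^sup>k\<^sup>l (\<partial>\<^sub>i g\<^sub>j\<^sub>l + \<partial>\<^sub>j g\<^sub>i\<^sub>l - \<partial>\<^sub>l g\<^sub>i\<^sub>j)\<close>, the coefficients of the
  Levi-Civita connection.\<close>

definition christoffel :: "('m, 'n::finite) chart set \<Rightarrow> ('m, 'n) metric_tensor \<Rightarrow>
    ('m, 'n) chart \<Rightarrow> real^'n \<Rightarrow> 'n \<Rightarrow> 'n \<Rightarrow> 'n \<Rightarrow> real" where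
  "christoffel A g c y k i j =
     (let dg = (\<lambda>l p q. frechet_derivative (\<lambda>z. metric_matrix A g c z $ p $ q) (at y) (axis l 1))
      in 1/2 * (\<Sum>l\<in>UNIV. matrix_inv (metric_matrix A g c y) $ k $ l *
                  (dg i j l + dg j i l - dg l i j)))"

text \<open>A geodesic is a curve whose velocity field \<open>W\<close> is parallel along it: the covariant
  derivative with components \<open>(W\<^sup>k)' + \<Sum>\<^sub>i\<^sub>j \<Gamma>\<^sup>k\<^sub>i\<^sub>j W\<^sup>i W\<^sup>j\<close> vanishes.\<close>

definition geodesic :: "('m::topological_space, 'n::finite) chart set \<Rightarrow>
    ('m, 'n) metric_tensor \<Rightarrow> real set \<Rightarrow> (real \<Rightarrow> 'm) \<Rightarrow> (real \<Rightarrow> ('m, 'n) tvec) \<Rightarrow> bool" where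
  "geodesic A g I \<gamma> W \<longleftrightarrow> continuous_on I \<gamma> \<and>
     (\<forall>t\<in>I. has_velocity A \<gamma> (W t) t I \<and>
       (\<forall>c\<in>charts_at A (\<gamma> t).
         ((\<lambda>s. W s c) has_vector_derivative
            (\<chi> k. - (\<Sum>i\<in>UNIV. \<Sum>j\<in>UNIV.
                christoffel A g c (coord c (\<gamma> t)) k i j * W t c $ i * W t c $ j)))
           (at t within I)))"

definition rexp :: "('m::topological_space, 'n::finite) chart set \<Rightarrow>
    ('m, 'n) metric_tensor \<Rightarrow> 'm \<Rightarrow> ('m, 'n) tvec \<Rightarrow> 'm" where
  "rexp A g x v = (THE y. \<exists>\<gamma> W. geodesic A g {0..1} \<gamma> W \<and> \<gamma> 0 = x \<and> W 0 = v \<and> \<gamma> 1 = y)"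

text \<open>\<open>exp\<^sub>x : B(O\<^sub>x, r) \<rightarrow> B\<^sub>x(r)\<close> is a diffeomorphism; the tangent space carries its smooth
  structure as a finite-dimensional vector space, given by linear coordinates \<open>u\<close>.\<close>

definition exp_diffeomorphism :: "('m::topological_space, 'n::finite) chart set \<Rightarrow>
    ('m, 'n) metric_tensor \<Rightarrow> 'm \<Rightarrow> ereal \<Rightarrow> bool" where
  "exp_diffeomorphism A g x r \<longleftrightarrow>
     bij_betw (rexp A g x) (tball A g x r) (rball A g x r) \<and>
     (\<forall>c\<in>charts_at A x.
       let B = {u. tangent_of A c x u \<in> tball A g x r};
           E = (\<lambda>u. rexp A g x (tangent_of A c x u));
           L = (\<lambda>y. inv_into (tball A g x r) (rexp A g x) y c)
       in continuous_on B E \<and>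
          (\<forall>d\<in>A. smooth_on {u\<in>B. E u \<in> cdom d} (coord d \<circ> E)) \<and>
          (\<forall>d\<in>A. smooth_on (coord d ` (rball A g x r \<inter> cdom d)) (L \<circ> coord_inv d)))"

definition injectivity_radius :: "('m::topological_space, 'n::finite) chart set \<Rightarrow>
    ('m, 'n) metric_tensor \<Rightarrow> 'm \<Rightarrow> ereal" where
  "injectivity_radius A g x = Sup {r. 0 < r \<and> exp_diffeomorphism A g x r}"

section \<open>Time-dependent vector fields and functions\<close>

definition time_vector_field :: "('m, 'n::finite) chart set \<Rightarrow> 'm set \<Rightarrow>
    (real \<Rightarrow> 'm \<Rightarrow> ('m, 'n) tvec) \<Rightarrow> bool" where
  "time_vector_field A D f \<longleftrightarrow> (\<forall>t\<ge>0. \<forall>x\<in>D. f t x \<in> tangent_space A x)"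

definition continuous_in_time :: "('m, 'n::finite) chart set \<Rightarrow> 'm set \<Rightarrow>
    (real \<Rightarrow> 'm \<Rightarrow> ('m, 'n) tvec) \<Rightarrow> bool" where
  "continuous_in_time A D f \<longleftrightarrow>
     (\<forall>x\<in>D. \<forall>c\<in>charts_at A x. continuous_on {0..} (\<lambda>t. f t x c))"

definition locally_lipschitz_in_space :: "('m::topological_space, 'n::finite) chart set \<Rightarrow>
    'm set \<Rightarrow> (real \<Rightarrow> 'm \<Rightarrow> ('m, 'n) tvec) \<Rightarrow> bool" where
  "locally_lipschitz_in_space A D f \<longleftrightarrow>
     (\<forall>c\<in>A. \<forall>x\<in>D \<inter> cdom c. \<forall>T\<ge>0. \<exists>U L. open U \<and> x \<in> U \<and> U \<subseteq> D \<inter> cdom c \<and>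
        (\<forall>t\<in>{0..T}. L-lipschitz_on (coord c ` U) (\<lambda>y. f t (coord_inv c y) c)))"

text \<open>\<open>C\<^sup>1\<close> on \<open>[0,\<infinity>) \<times> D\<close>, with one-sided time derivatives at \<open>t = 0\<close>.\<close>

definition C1_time_function :: "('m, 'n::finite) chart set \<Rightarrow> 'm set \<Rightarrow>
    (real \<Rightarrow> 'm \<Rightarrow> real) \<Rightarrow> bool" where
  "C1_time_function A D V \<longleftrightarrow>
     (\<forall>c\<in>A. let S = {0..} \<times> coord c ` (D \<inter> cdom c) in
        \<exists>F :: real \<times> (real^'n) \<Rightarrow> (real \<times> (real^'n)) \<Rightarrow>\<^sub>L real.
          continuous_on S F \<and>
          (\<forall>p\<in>S. ((\<lambda>(t, y). V t (coord_inv c y)) has_derivative blinfun_apply (F p))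
                    (at p within S)))"

definition time_deriv :: "(real \<Rightarrow> 'm \<Rightarrow> real) \<Rightarrow> real \<Rightarrow> 'm \<Rightarrow> real" where
  "time_deriv V t x = vector_derivative (\<lambda>s. V s x) (at t within {0..})"

section \<open>Solutions and exponential stability\<close>

definition solution_from :: "('m::topological_space, 'n::finite) chart set \<Rightarrow> 'm set \<Rightarrow>
    (real \<Rightarrow> 'm \<Rightarrow> ('m, 'n) tvec) \<Rightarrow> real \<Rightarrow> (real \<Rightarrow> 'm) \<Rightarrow> bool" where
  "solution_from A D f t0 x \<longleftrightarrow> continuous_on {t0..} x \<and>
     (\<forall>t\<ge>t0. x t \<in> D \<and> has_velocity A x (f t (x t)) t {t0..})"

text \<open>The existence of a solution on the whole of \<open>[t\<^sub>0,\<infinity>)\<close> is part of exponential stability;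
  without it the estimate would hold vacuously along solutions leaving \<open>D\<close>.\<close>

definition exponentially_stable_in :: "('m::topological_space, 'n::finite) chart set \<Rightarrow>
    ('m, 'n) metric_tensor \<Rightarrow> 'm set \<Rightarrow> (real \<Rightarrow> 'm \<Rightarrow> ('m, 'n) tvec) \<Rightarrow> 'm \<Rightarrow> 'm set \<Rightarrow> bool" where
  "exponentially_stable_in A g D f x\<^sub>e D' \<longleftrightarrow> D' \<subseteq> D \<and>
     (\<exists>k>0. \<exists>\<mu>>0. \<forall>t0\<ge>0. \<forall>x0\<in>D'.
        (\<exists>x. solution_from A D f t0 x \<and> x t0 = x0) \<and>
        (\<forall>x. solution_from A D f t0 x \<and> x t0 = x0 \<longrightarrow>
           (\<forall>t\<ge>t0. rdist A g x\<^sub>e (x t) \<le> k * rdist A g x\<^sub>e (x t0) * exp (- \<mu> * (t - t0)))))"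

end

theory Submission
  imports Defs
begin

text \<open>Along a solution \<open>V\<close> decays like \<open>exp (- (k\<^sub>3 / k\<^sub>2) t)\<close>, and the two-sided bound on \<open>V\<close>
  turns this into the estimate for \<open>\<rho>\<close>. What remains is the existence of the solution for all
  times. With \<open>R = (k\<^sub>2 / k\<^sub>1)\<^sup>1\<^sup>/\<^sup>a \<rho>(x\<^sub>e, x(t\<^sub>0)) < r\<^sub>0\<close>, the sublevel sets
  \<open>{q. V(t, q) \<le> k\<^sub>1 R\<^sup>a}\<close> are positively invariant and contained in the closed ball of radius
  \<open>R\<close>, which lies in \<open>D\<close>. This ball is compact by the Hopf-Rinow theorem, so the local existence
  time is bounded below along the solution. Compactness comes from the fact that \<open>\<rho>\<close> is a
  complete, locally compact length metric inducing the manifold topology.\<close>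

section \<open>Local existence for ordinary differential equations\<close>

text \<open>The radius in the theorem is where the two bounds on \<open>V\<close> meet: if the
  initial distance is (k1/k2)^(1/a) R, the upper bound k2 \<rho>^a at the start equals k1 R^a, the
  least value that the lower bound allows at distance R. The strict inequality R <
  \<open>r\<^sub>0\<close> matters because \<open>r\<^sub>0\<close> is only a supremum: some open
  ball of radius above R lies in \<open>D\<close>, and with it the closed ball of radius R.

  The obstacle is that \<rho> is given only as an infimum of lengths. Local control over it comes
  from comparing the metric with the Euclidean norm on a compact coordinate ball, m |u| \<le> |u|_g
  \<le> M |u|. The upper bound, applied to coordinate segments, makes \<rho> small near a point; the
  lower bound, applied to curves up to their first exit, separates points and traps small
  \<rho>-balls in a chart. Passing from compact small balls to compact balls of any radius is then
  pure metric geometry.\<close>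

lemma continuous_on_lipschitz_compose:
  fixes F :: "'t::topological_space \<Rightarrow> 'a::metric_space \<Rightarrow> 'b::real_normed_vector"
  assumes lip: "\<And>t. t \<in> I \<Longrightarrow> L-lipschitz_on C (F t)"
    and cont: "\<And>y. y \<in> C \<Longrightarrow> continuous_on I (\<lambda>t. F t y)"
    and h: "continuous_on I h" "\<And>t. t \<in> I \<Longrightarrow> h t \<in> C"
  shows "continuous_on I (\<lambda>t. F t (h t))"
  unfolding continuous_on_def
proof
  fix t assume t: "t \<in> I"
  have "((\<lambda>s. dist (h s) (h t)) \<longlongrightarrow> dist (h t) (h t)) (at t within I)"
    using h(1) t unfolding continuous_on_def by (intro tendsto_intros) auto
  then have "((\<lambda>s. L * dist (h s) (h t)) \<longlongrightarrow> 0) (at t within I)"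
    using tendsto_mult_right_zero by fastforce
  moreover have "\<forall>\<^sub>F s in at t within I. norm (F s (h s) - F s (h t)) \<le> L * dist (h s) (h t)"
    unfolding eventually_at_filter
    using lipschitz_onD[OF lip] h(2) t by (auto simp: dist_norm intro!: always_eventually)
  ultimately have "((\<lambda>s. F s (h s) - F s (h t)) \<longlongrightarrow> 0) (at t within I)"
    by (rule Lim_null_comparison[rotated])
  moreover have "((\<lambda>s. F s (h t)) \<longlongrightarrow> F t (h t)) (at t within I)"
    using cont[OF h(2)[OF t]] t unfolding continuous_on_def by blast
  ultimately have "((\<lambda>s. F s (h s) - F s (h t) + F s (h t)) \<longlongrightarrow> 0 + F t (h t)) (at t within I)"
    by (rule tendsto_add)
  then show "((\<lambda>s. F s (h s)) \<longlongrightarrow> F t (h t)) (at t within I)" by simp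
qed

text \<open>Composing with the nearest-point projection onto the ball makes the right-hand side
  globally Lipschitz; the bound on \<open>\<delta>\<close> keeps the fixed point inside the ball, where the
  projection is the identity.\<close>

lemma picard_lindelof_uniform:
  fixes F :: "real \<Rightarrow> 'a::euclidean_space \<Rightarrow> 'a"
  assumes "0 < b" "0 < T"
    and lip: "\<And>t. t \<in> {0..T} \<Longrightarrow> L-lipschitz_on (cball y0 (2*b)) (F t)"
    and cont: "\<And>y. y \<in> cball y0 (2*b) \<Longrightarrow> continuous_on {0..T} (\<lambda>t. F t y)"
  obtains \<delta> where "0 < \<delta>" "\<delta> \<le> 1"
    "\<And>s q. 0 \<le> s \<Longrightarrow> s + \<delta> \<le> T \<Longrightarrow> q \<in> cball y0 b \<Longrightarrow>
      \<exists>y. y s = q \<and> (\<forall>t\<in>{s..s+\<delta>}. y t \<in> cball y0 (2*b) \<and>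
            (y has_vector_derivative F t (y t)) (at t within {s..s+\<delta>}))"
proof -
  let ?C = "cball y0 (2*b)"
  let ?cp = "closest_point ?C"
  have L: "0 \<le> L" using lip[of 0] \<open>0 < T\<close> by (auto simp: lipschitz_on_def)
  have C: "convex ?C" "closed ?C" "?C \<noteq> {}" using \<open>0 < b\<close> by auto
  have "compact ((\<lambda>t. F t y0) ` {0..T})"
    by (rule compact_continuous_image[OF cont]) (use \<open>0 < b\<close> in auto)
  then obtain B where B: "\<And>t. t \<in> {0..T} \<Longrightarrow> norm (F t y0) \<le> B"
    using compact_imp_bounded bounded_iff by (metis imageI)
  \<comment> \<open>A bound for \<open>F\<close> on the large ball: the bound \<open>B\<close> at
    the centre plus the Lipschitz variation over distance \<open>2*b\<close>. The summand 1 makes it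
    positive, as \<open>b / M\<close> requires.\<close>
  define M where "M = B + L * (2*b) + 1"
  have "0 \<le> B" using order_trans[OF norm_ge_zero B[of 0]] \<open>0 < T\<close> by simp
  then have "0 < M" using L \<open>0 < b\<close> by (simp add: M_def add_nonneg_pos)
  have M: "norm (F t y) \<le> M" if "t \<in> {0..T}" "y \<in> ?C" for t y
  proof -
    have "norm (F t y - F t y0) \<le> L * dist y y0"
      using lipschitz_onD[OF lip[OF that(1)] that(2), of y0] \<open>0 < b\<close> by (simp add: dist_norm)
    also have "\<dots> \<le> L * (2*b)" using that L by (intro mult_left_mono) (auto simp: dist_commute)
    finally show ?thesis
      using norm_triangle_sub[of "F t y" "F t y0"] B[OF that(1)] by (simp add: M_def)
  qed
  \<comment> \<open>The first term gives contraction factor 1/2, with \<open>L + 1\<close> covering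
    the case \<open>L = 0\<close>. The second limits the displacement to \<open>b\<close>, so a
    start in the ball of radius \<open>b\<close> stays within \<open>2*b\<close>. Neither depends on
    \<open>s\<close> or \<open>q\<close>.\<close>
  define \<delta> where "\<delta> = min (1 / (2 * (L + 1))) (b / M)"
  have "0 < \<delta>" using L \<open>0 < b\<close> \<open>0 < M\<close> by (simp add: \<delta>_def)
  have "1 / (2 * (L + 1)) \<le> 1" using L by (simp add: divide_simps)
  then have "\<delta> \<le> 1" by (simp add: \<delta>_def)
  have "\<delta> * L \<le> 1 / (2 * (L + 1)) * (L + 1)"
    using L by (intro mult_mono) (auto simp: \<delta>_def)
  moreover have "1 / (2 * (L + 1)) * (L + 1) = 1/2" using L by (simp add: field_simps)
  ultimately have \<delta>L: "\<delta> * L \<le> 1/2" by (rule ord_le_eq_trans)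
  have "\<delta> \<le> b / M" by (simp add: \<delta>_def)
  then have \<delta>M: "M * \<delta> \<le> b" using \<open>0 < M\<close> by (simp add: field_simps)
  have cpC: "?cp y \<in> ?C" for y using C(2,3) by (rule closest_point_in_set)
  have ex: "\<exists>y. y s = q \<and> (\<forall>t\<in>{s..s+\<delta>}. y t \<in> ?C \<and>
            (y has_vector_derivative F t (y t)) (at t within {s..s+\<delta>}))"
    if s: "0 \<le> s" "s + \<delta> \<le> T" and q: "q \<in> cball y0 b" for s q
  proof -
    let ?I = "{s..s+\<delta>}"
    have I: "?I \<subseteq> {0..T}" using s by auto
    \<comment> \<open>\<open>F\<close> is continuous in time only for each fixed point; the
      Lipschitz constant uniform in time supplies continuity along a moving point.\<close>
    have contG: "continuous_on ?I (\<lambda>t. F t (?cp (\<phi> t)))" if "continuous_on ?I \<phi>" for \<phi>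
    proof (rule continuous_on_lipschitz_compose[where F = F and L = L and h = "\<lambda>t. ?cp (\<phi> t)" and C = ?C])
      show "continuous_on ?I (\<lambda>t. ?cp (\<phi> t))"
        by (rule continuous_on_compose2[OF continuous_on_closest_point[OF C] that]) auto
      show "L-lipschitz_on ?C (F t)" if "t \<in> ?I" for t using lip that I by blast
      show "continuous_on ?I (\<lambda>t. F t y)" if "y \<in> ?C" for y
        using continuous_on_subset[OF cont[OF that] I] .
    qed (rule cpC)
    define P where "P = (\<lambda>\<phi> t. q + integral {s..t} (\<lambda>r. F r (?cp (\<phi> r))))"
    \<comment> \<open>Clamping to the interval turns functions on \<open>?I\<close> into bounded
      continuous functions on the whole line, a complete type on which Banach's fixed point theorem
      applies.\<close>
    define k where "k = (\<lambda>t. max s (min (s + \<delta>) t))"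
    have k: "k t \<in> ?I" for t using \<open>0 < \<delta>\<close> by (simp add: k_def)
    have kid: "k t = t" if "t \<in> ?I" for t using that by (simp add: k_def)
    have contP: "continuous_on ?I (P \<phi>)" if "continuous_on ?I \<phi>" for \<phi>
      unfolding P_def
      by (intro continuous_intros indefinite_integral_continuous_1 integrable_continuous_interval contG that)
    have bc: "(\<lambda>t. P \<phi> (k t)) \<in> bcontfun" if "continuous_on ?I \<phi>" for \<phi>
      unfolding bcontfun_def
    proof (intro CollectI conjI)
      have "continuous_on UNIV k" unfolding k_def by (intro continuous_intros)
      then show "continuous_on UNIV (\<lambda>t. P \<phi> (k t))"
        by (rule continuous_on_compose2[OF contP[OF that]]) (use k in auto)
      show "bounded (range (\<lambda>t. P \<phi> (k t)))"
        by (rule bounded_subset[OF compact_imp_bounded[OF compact_continuous_image[OF contP[OF that]]]])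
           (use k in auto)
    qed
    define Q where "Q = (\<lambda>\<phi> :: real \<Rightarrow>\<^sub>C 'a. Bcontfun (\<lambda>t. P (apply_bcontfun \<phi>) (k t)))"
    have Q: "apply_bcontfun (Q \<phi>) t = P \<phi> (k t)" for \<phi> t
      unfolding Q_def by (subst Bcontfun_inverse[OF bc]) auto
    have "dist (Q \<phi>) (Q \<psi>) \<le> 1/2 * dist \<phi> \<psi>" for \<phi> \<psi>
    proof (rule dist_bound)
      fix t
      let ?t = "k t"
      have sub: "{s..?t} \<subseteq> ?I" using k[of t] by auto
      have c: "continuous_on {s..?t} (\<lambda>r. F r (?cp (\<xi> r)))" for \<xi> :: "real \<Rightarrow>\<^sub>C 'a"
        using contG[of \<xi>] continuous_on_subset[OF _ sub] by auto
      have "dist (Q \<phi> t) (Q \<psi> t)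
          = norm (integral {s..?t} (\<lambda>r. F r (?cp (\<phi> r)) - F r (?cp (\<psi> r))))"
        by (simp add: Q P_def dist_norm integral_diff[OF integrable_continuous_interval integrable_continuous_interval] c)
      also have "\<dots> \<le> (L * dist \<phi> \<psi>) * (?t - s)"
      proof (rule integral_bound)
        show "s \<le> ?t" using k[of t] by simp
        show "continuous_on {s..?t} (\<lambda>r. F r (?cp (\<phi> r)) - F r (?cp (\<psi> r)))"
          by (intro continuous_intros c)
        fix r assume "r \<in> {s..?t}"
        then have r: "r \<in> {0..T}" using sub I by blast
        have "norm (F r (?cp (\<phi> r)) - F r (?cp (\<psi> r))) \<le> L * dist (?cp (\<phi> r)) (?cp (\<psi> r))"
          using lipschitz_onD[OF lip[OF r] cpC cpC] by (simp add: dist_norm)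
        also have "\<dots> \<le> L * dist (\<phi> r) (\<psi> r)"
          by (intro mult_left_mono closest_point_lipschitz C L)
        also have "\<dots> \<le> L * dist \<phi> \<psi>" by (intro mult_left_mono dist_bounded L)
        finally show "norm (F r (?cp (\<phi> r)) - F r (?cp (\<psi> r))) \<le> L * dist \<phi> \<psi>" .
      qed
      also have "\<dots> \<le> (L * dist \<phi> \<psi>) * \<delta>"
        using k[of t] L by (intro mult_left_mono) auto
      also have "\<dots> = (\<delta> * L) * dist \<phi> \<psi>" by simp
      also have "\<dots> \<le> 1/2 * dist \<phi> \<psi>" by (intro mult_right_mono \<delta>L) simp
      finally show "dist (Q \<phi> t) (Q \<psi> t) \<le> 1/2 * dist \<phi> \<psi>" .
    qed
    then obtain \<phi> where fix': "Q \<phi> = \<phi>"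
      using banach_fix_type[of "1/2" Q] by auto
    have \<phi>: "\<phi> t = P \<phi> t" if "t \<in> ?I" for t
      using Q[of \<phi> t] kid[OF that] by (simp add: fix')
    have c\<phi>: "continuous_on ?I (\<lambda>r. F r (?cp (\<phi> r)))" by (rule contG) simp
    have in_C: "\<phi> t \<in> ?C" if t: "t \<in> ?I" for t
    proof -
      have "norm (integral {s..t} (\<lambda>r. F r (?cp (\<phi> r)))) \<le> M * (t - s)"
        by (rule integral_bound)
           (use t I M cpC in \<open>auto intro: continuous_on_subset[OF c\<phi>]\<close>)
      also have "\<dots> \<le> M * \<delta>" using t \<open>0 < M\<close> by (intro mult_left_mono) auto
      finally have "norm (\<phi> t - q) \<le> b" using \<phi>[OF t] \<delta>M by (simp add: P_def)
      then show ?thesis using q norm_triangle_ineq[of "\<phi> t - q" "q - y0"]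
        by (simp add: dist_norm norm_minus_commute)
    qed
    have "(\<phi> has_vector_derivative F t (\<phi> t)) (at t within ?I)" if t: "t \<in> ?I" for t
    proof -
      have "((\<lambda>u. q + integral {s..u} (\<lambda>r. F r (?cp (\<phi> r)))) has_vector_derivative 0 + F t (?cp (\<phi> t)))
          (at t within ?I)"
        by (intro derivative_intros integral_has_vector_derivative c\<phi> t)
      then have "(P \<phi> has_vector_derivative F t (\<phi> t)) (at t within ?I)"
        by (simp add: P_def closest_point_self[OF in_C[OF t]])
      then show ?thesis
        by (rule has_vector_derivative_transform[OF t, rotated]) (use \<phi> in auto)
    qed
    moreover have "\<phi> s = q" using \<phi>[of s] \<open>0 < \<delta>\<close> by (simp add: P_def)
    ultimately show ?thesis using in_C by blast
  qed
  show ?thesis by (rule that[OF \<open>0 < \<delta>\<close> \<open>\<delta> \<le> 1\<close> ex])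
qed

section \<open>Charts, tangent vectors and the metric in coordinates\<close>

lemma smooth_on_imp_continuous_on: "smooth_on S h \<Longrightarrow> continuous_on S h"
  unfolding smooth_on_def by (metis Ck_on.simps(1))

lemma smooth_on_has_derivative:
  assumes "smooth_on S h" "open S" "y \<in> S"
  shows "(h has_derivative frechet_derivative h (at y)) (at y)"
proof -
  have "Ck_on (Suc 0) S h" using assms(1) unfolding smooth_on_def by blast
  then have "h differentiable_on S" by simp
  then show ?thesis
    using assms(2,3) by (simp add: differentiable_on_eq_differentiable_at frechet_derivative_works)
qed

lemma smooth_on_continuous_derivative:
  assumes "smooth_on S h"
  shows "continuous_on S (\<lambda>y. frechet_derivative h (at y) v)"
proof -
  have "Ck_on (Suc 0) S h" using assms unfolding smooth_on_def by blast
  then show ?thesis by simp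
qed

locale atlas =
  fixes A :: "('m::{t2_space, second_countable_topology}, 'n::finite) chart set"
  assumes smooth_atlas: "smooth_atlas A"
begin

lemma is_chart: "c \<in> A \<Longrightarrow> is_chart c"
  using smooth_atlas by (simp add: smooth_atlas_def)

lemma open_cdom: "c \<in> A \<Longrightarrow> open (cdom c)"
  using is_chart is_chart_def by blast

lemma open_range: "c \<in> A \<Longrightarrow> open (coord c ` cdom c)"
  using is_chart is_chart_def by blast

lemma chart_homeomorphism:
  "c \<in> A \<Longrightarrow> homeomorphism (cdom c) (coord c ` cdom c) (coord c) (coord_inv c)"
  using is_chart is_chart_def by blast

lemma coord_inv_coord [simp]: "c \<in> A \<Longrightarrow> x \<in> cdom c \<Longrightarrow> coord_inv c (coord c x) = x"
  using chart_homeomorphism by (simp add: homeomorphism_def)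

lemma coord_coord_inv [simp]: "c \<in> A \<Longrightarrow> y \<in> coord c ` cdom c \<Longrightarrow> coord c (coord_inv c y) = y"
  by auto

lemma continuous_on_coord: "c \<in> A \<Longrightarrow> continuous_on (cdom c) (coord c)"
  using chart_homeomorphism by (simp add: homeomorphism_def)

lemma continuous_on_coord_inv: "c \<in> A \<Longrightarrow> continuous_on (coord c ` cdom c) (coord_inv c)"
  using chart_homeomorphism by (simp add: homeomorphism_def)

lemma open_coord_image:
  assumes "c \<in> A" "open U" "U \<subseteq> cdom c"
  shows "open (coord c ` U)"
proof -
  have "coord c ` U = coord_inv c -` U \<inter> coord c ` cdom c"
    using assms by force
  then show ?thesis
    using continuous_on_open_vimage[OF open_range[OF assms(1)]] continuous_on_coord_inv assms
    by (metis)
qed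

lemma open_coord_inv_image:
  assumes "c \<in> A" "open W" "W \<subseteq> coord c ` cdom c"
  shows "open (coord_inv c ` W)"
proof -
  have "coord_inv c ` W = coord c -` W \<inter> cdom c"
    using assms by (auto simp: subset_iff image_iff) (metis coord_coord_inv coord_inv_coord imageE imageI)+
  then show ?thesis
    using continuous_on_open_vimage[OF open_cdom[OF assms(1)]] continuous_on_coord assms
    by (metis)
qed

lemma chart_exists: "\<exists>c\<in>A. x \<in> cdom c"
  using smooth_atlas unfolding smooth_atlas_def by blast

lemma charts_at_iff: "c \<in> charts_at A x \<longleftrightarrow> c \<in> A \<and> x \<in> cdom c"
  by (simp add: charts_at_def)

lemma transition_smooth:
  "c \<in> A \<Longrightarrow> d \<in> A \<Longrightarrow> smooth_on (coord c ` (cdom c \<inter> cdom d)) (coord d \<circ> coord_inv c)"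
  using smooth_atlas by (simp add: smooth_atlas_def)

lemma open_overlap: "c \<in> A \<Longrightarrow> d \<in> A \<Longrightarrow> open (coord c ` (cdom c \<inter> cdom d))"
  by (intro open_coord_image) (auto intro: open_cdom open_Int)

section \<open>Derivatives of transition maps and the tangent spaces they define\<close>

lemma transition_has_derivative:
  assumes "c \<in> charts_at A x" "d \<in> charts_at A x"
  shows "((coord d \<circ> coord_inv c) has_derivative transition_deriv c d x) (at (coord c x))"
  unfolding transition_deriv_def
  by (rule smooth_on_has_derivative[OF transition_smooth open_overlap])
     (use assms in \<open>auto simp: charts_at_iff\<close>)

lemma linear_transition_deriv:
  "c \<in> charts_at A x \<Longrightarrow> d \<in> charts_at A x \<Longrightarrow> linear (transition_deriv c d x)"
  using transition_has_derivative has_derivative_linear by blast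

text \<open>This is the chain rule. The composite of the two transition maps agrees with the direct
  one only on the overlap of \<open>c\<close> and \<open>d\<close>, which is an open neighbourhood
  of the point in coordinates.\<close>

lemma transition_deriv_cocycle:
  assumes "c \<in> charts_at A x" "d \<in> charts_at A x" "e \<in> charts_at A x"
  shows "transition_deriv d e x (transition_deriv c d x u) = transition_deriv c e x u"
proof -
  let ?W = "coord c ` (cdom c \<inter> cdom d)"
  have cd: "c \<in> A" "d \<in> A" "x \<in> cdom c" "x \<in> cdom d" using assms by (auto simp: charts_at_iff)
  have "((coord e \<circ> coord_inv d) has_derivative transition_deriv d e x)
      (at ((coord d \<circ> coord_inv c) (coord c x)))"
    using transition_has_derivative[OF assms(2,3)] cd by simp
  from diff_chain_at[OF transition_has_derivative[OF assms(1,2)] this]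
  have "((coord e \<circ> coord_inv d \<circ> (coord d \<circ> coord_inv c)) has_derivative
      (transition_deriv d e x \<circ> transition_deriv c d x)) (at (coord c x))" .
  then have "((coord e \<circ> coord_inv c) has_derivative
      (transition_deriv d e x \<circ> transition_deriv c d x)) (at (coord c x))"
    by (rule has_derivative_transform_within_open[OF _ open_overlap[OF cd(1,2)]])
       (use cd in auto)
  from has_derivative_unique[OF this transition_has_derivative[OF assms(1,3)]]
  show ?thesis by (metis comp_apply)
qed

lemma transition_deriv_self: "c \<in> charts_at A x \<Longrightarrow> transition_deriv c c x u = u"
proof -
  assume c: "c \<in> charts_at A x"
  then have cA: "c \<in> A" "x \<in> cdom c" by (auto simp: charts_at_iff)
  have "((\<lambda>y. y) has_derivative transition_deriv c c x) (at (coord c x))"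
    by (rule has_derivative_transform_within_open[OF transition_has_derivative[OF c c]
          open_range[OF cA(1)]]) (use cA in auto)
  from has_derivative_unique[OF this has_derivative_ident] show ?thesis by metis
qed

lemma tangent_of_in: "c \<in> charts_at A x \<Longrightarrow> tangent_of A c x u \<in> tangent_space A x"
  by (auto simp: tangent_space_def tangent_of_def transition_deriv_cocycle)

lemma tangent_of_same: "c \<in> charts_at A x \<Longrightarrow> tangent_of A c x u c = u"
  by (simp add: tangent_of_def transition_deriv_self)

lemma tangent_space_transform:
  "v \<in> tangent_space A x \<Longrightarrow> c \<in> charts_at A x \<Longrightarrow> d \<in> charts_at A x \<Longrightarrow>
    transition_deriv c d x (v c) = v d"
  unfolding tangent_space_def mem_Collect_eq by metis

lemma tangent_space_outside: "v \<in> tangent_space A x \<Longrightarrow> c \<notin> charts_at A x \<Longrightarrow> v c = 0"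
  unfolding tangent_space_def by blast

lemma tangent_spaceI:
  assumes "\<And>c d. c \<in> charts_at A x \<Longrightarrow> d \<in> charts_at A x \<Longrightarrow> v d = transition_deriv c d x (v c)"
    and "\<And>c. c \<notin> charts_at A x \<Longrightarrow> v c = 0"
  shows "v \<in> tangent_space A x"
  using assms unfolding tangent_space_def by blast

text \<open>With \<open>tangent_of_same\<close>, this makes evaluation in one chart an isomorphism
  from the tangent space to \<open>real^'n\<close>, so identities of tangent vectors can be checked
  in a single chart.\<close>

lemma tangent_of_coord:
  assumes "c \<in> charts_at A x" "v \<in> tangent_space A x"
  shows "tangent_of A c x (v c) = v"
proof
  fix d show "tangent_of A c x (v c) d = v d"
    using tangent_space_transform[OF assms(2,1)] tangent_space_outside[OF assms(2)]
    unfolding tangent_of_def by presburger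
qed

lemma tangent_space_zero: "(\<lambda>c. 0) \<in> tangent_space A x"
  by (rule tangent_spaceI) (simp_all add: linear_0[OF linear_transition_deriv])

lemma tangent_space_scale:
  assumes v: "v \<in> tangent_space A x"
  shows "(\<lambda>c. k *\<^sub>R v c) \<in> tangent_space A x"
proof (rule tangent_spaceI)
  fix c d assume cd: "c \<in> charts_at A x" "d \<in> charts_at A x"
  show "k *\<^sub>R v d = transition_deriv c d x (k *\<^sub>R v c)"
    by (simp add: linear_scale[OF linear_transition_deriv[OF cd]] tangent_space_transform[OF v cd])
qed (simp add: tangent_space_outside[OF v])

lemma tangent_space_combination:
  assumes "finite I" "\<And>i. i \<in> I \<Longrightarrow> v i \<in> tangent_space A x"
  shows "(\<lambda>c. \<Sum>i\<in>I. k i *\<^sub>R v i c) \<in> tangent_space A x"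
proof (rule tangent_spaceI)
  fix c d assume cd: "c \<in> charts_at A x" "d \<in> charts_at A x"
  show "(\<Sum>i\<in>I. k i *\<^sub>R v i d) = transition_deriv c d x (\<Sum>i\<in>I. k i *\<^sub>R v i c)"
    by (simp add: linear_sum[OF linear_transition_deriv[OF cd]]
        linear_scale[OF linear_transition_deriv[OF cd]] tangent_space_transform[OF assms(2) cd])
next
  fix c assume "c \<notin> charts_at A x"
  then show "(\<Sum>i\<in>I. k i *\<^sub>R v i c) = 0"
    by (intro sum.neutral) (simp add: tangent_space_outside[OF assms(2)])
qed

lemma tangent_of_basis_expansion:
  assumes c: "c \<in> charts_at A x"
  shows "tangent_of A c x u = (\<lambda>d. \<Sum>i\<in>UNIV. u $ i *\<^sub>R tangent_of A c x (axis i 1) d)"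
    (is "_ = ?w")
proof -
  have w: "?w \<in> tangent_space A x"
    by (rule tangent_space_combination) (auto intro: tangent_of_in c)
  have "?w c = u"
    by (simp add: tangent_of_same[OF c] basis_expansion flip: scalar_mult_eq_scaleR)
  with tangent_of_coord[OF c w] show ?thesis by simp
qed

text \<open>Velocity asks for a derivative in every chart at the point; the chain rule with the
  transition map reduces this to one chart. Continuity of the curve is needed because the transition
  map describes it only while it stays in \<open>cdom c\<close>.\<close>

lemma has_velocity_iff_chart:
  assumes c: "c \<in> charts_at A (\<gamma> t)" and "t \<in> I" and cont: "continuous_on I \<gamma>"
    and v: "v \<in> tangent_space A (\<gamma> t)"
  shows "has_velocity A \<gamma> v t I \<longleftrightarrow> ((coord c \<circ> \<gamma>) has_vector_derivative v c) (at t within I)"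
proof
  assume "has_velocity A \<gamma> v t I"
  then show "((coord c \<circ> \<gamma>) has_vector_derivative v c) (at t within I)"
    using c by (simp add: has_velocity_def)
next
  assume D: "((coord c \<circ> \<gamma>) has_vector_derivative v c) (at t within I)"
  have cA: "c \<in> A" "\<gamma> t \<in> cdom c" using c by (auto simp: charts_at_iff)
  have ev: "\<forall>\<^sub>F s in at t within I. \<gamma> s \<in> cdom c"
    using topological_tendstoD[OF _ open_cdom[OF cA(1)] cA(2)] cont \<open>t \<in> I\<close>
    unfolding continuous_on_def by blast
  show "has_velocity A \<gamma> v t I"
    unfolding has_velocity_def
  proof (intro conjI ballI v)
    fix d assume d: "d \<in> charts_at A (\<gamma> t)"
    have T: "((coord d \<circ> coord_inv c) has_derivative transition_deriv c d (\<gamma> t)) (at ((coord c \<circ> \<gamma>) t))"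
      using transition_has_derivative[OF c d] by simp
    have "(((coord d \<circ> coord_inv c) \<circ> (coord c \<circ> \<gamma>)) has_derivative
        (transition_deriv c d (\<gamma> t) \<circ> (\<lambda>h. h *\<^sub>R v c))) (at t within I)"
      using D[unfolded has_vector_derivative_def] has_derivative_at_withinI[OF T]
      by (rule diff_chain_within)
    then have "((coord d \<circ> \<gamma>) has_derivative
        (transition_deriv c d (\<gamma> t) \<circ> (\<lambda>h. h *\<^sub>R v c))) (at t within I)"
      by (rule has_derivative_transform_eventually)
         (use ev cA \<open>t \<in> I\<close> in \<open>auto elim: eventually_mono\<close>)
    moreover have "transition_deriv c d (\<gamma> t) \<circ> (\<lambda>h. h *\<^sub>R v c) = (\<lambda>h. h *\<^sub>R v d)"
      using linear_scale[OF linear_transition_deriv[OF c d]] tangent_space_transform[OF v c d]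
      by (simp add: fun_eq_iff)
    ultimately show "((coord d \<circ> \<gamma>) has_vector_derivative v d) (at t within I)"
      by (simp add: has_vector_derivative_def)
  qed
qed

end

section \<open>The metric as a quadratic form in coordinates\<close>

locale riemannian = atlas A
  for A :: "('m::{t2_space, second_countable_topology}, 'n::finite) chart set" +
  fixes g :: "('m, 'n) metric_tensor"
  assumes riemannian_metric: "riemannian_metric A g"
begin

lemma metric_linear:
  assumes "u \<in> tangent_space A x" "v \<in> tangent_space A x" "w \<in> tangent_space A x"
  shows "g x (\<lambda>c. a *\<^sub>R u c + b *\<^sub>R v c) w = a * g x u w + b * g x v w"
  using riemannian_metric assms unfolding riemannian_metric_def by blast

lemma metric_sym: "u \<in> tangent_space A x \<Longrightarrow> v \<in> tangent_space A x \<Longrightarrow> g x u v = g x v u"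
  using riemannian_metric unfolding riemannian_metric_def by blast

lemma metric_pos: "u \<in> tangent_space A x \<Longrightarrow> u \<noteq> (\<lambda>c. 0) \<Longrightarrow> g x u u > 0"
  using riemannian_metric unfolding riemannian_metric_def by blast

lemma metric_matrix_smooth:
  "c \<in> A \<Longrightarrow> smooth_on (coord c ` cdom c) (\<lambda>y. metric_matrix A g c y $ i $ j)"
  using riemannian_metric unfolding riemannian_metric_def by blast

lemma metric_scale:
  assumes "v \<in> tangent_space A x" "w \<in> tangent_space A x"
  shows "g x (\<lambda>c. k *\<^sub>R v c) w = k * g x v w"
  using metric_linear[OF assms(1) assms(1) assms(2), of k 0] by simp

lemma metric_sum:
  assumes "finite I" "\<And>i. i \<in> I \<Longrightarrow> v i \<in> tangent_space A x" "w \<in> tangent_space A x"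
  shows "g x (\<lambda>c. \<Sum>i\<in>I. k i *\<^sub>R v i c) w = (\<Sum>i\<in>I. k i * g x (v i) w)"
  using assms
proof (induction I rule: finite_induct)
  case empty
  then show ?case
    using metric_scale[OF tangent_space_zero, of w x 0] by simp
next
  case (insert j I)
  have "g x (\<lambda>c. \<Sum>i\<in>insert j I. k i *\<^sub>R v i c) w
      = g x (\<lambda>c. k j *\<^sub>R v j c + 1 *\<^sub>R (\<Sum>i\<in>I. k i *\<^sub>R v i c)) w"
    using insert.hyps by simp
  also have "\<dots> = k j * g x (v j) w + 1 * g x (\<lambda>c. \<Sum>i\<in>I. k i *\<^sub>R v i c) w"
    by (rule metric_linear) (use insert in \<open>auto intro: tangent_space_combination\<close>)
  also have "\<dots> = (\<Sum>i\<in>insert j I. k i * g x (v i) w)"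
    using insert by simp
  finally show ?case .
qed

text \<open>The quadratic form g_ij u^i u^j of the metric at the point with coordinates
  \<open>y\<close>.\<close>

definition chart_form :: "('m, 'n) chart \<Rightarrow> real^'n \<Rightarrow> real^'n \<Rightarrow> real" where
  "chart_form c y u = (\<Sum>i\<in>UNIV. \<Sum>j\<in>UNIV. u $ i * (u $ j * metric_matrix A g c y $ i $ j))"

text \<open>\<open>metric_linear\<close> gives linearity in the first argument only, so the vector
  is expanded there, the arguments are exchanged by symmetry, and the other copy is expanded in the
  same place.\<close>

lemma metric_chart:
  assumes c: "c \<in> charts_at A x"
  shows "g x (tangent_of A c x u) (tangent_of A c x u) = chart_form c (coord c x) u"
proof -
  let ?e = "\<lambda>i. tangent_of A c x (axis i 1)"
  have e: "?e i \<in> tangent_space A x" for i by (rule tangent_of_in[OF c])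
  have u: "tangent_of A c x u \<in> tangent_space A x" by (rule tangent_of_in[OF c])
  have "g x (tangent_of A c x u) (tangent_of A c x u) = (\<Sum>i\<in>UNIV. u $ i * g x (?e i) (tangent_of A c x u))"
    by (subst tangent_of_basis_expansion[OF c]) (use e u in \<open>simp add: metric_sum\<close>)
  also have "\<dots> = (\<Sum>i\<in>UNIV. u $ i * g x (tangent_of A c x u) (?e i))"
    by (intro sum.cong refl arg_cong2[where f = "(*)"] metric_sym e u)
  also have "\<dots> = (\<Sum>i\<in>UNIV. u $ i * (\<Sum>j\<in>UNIV. u $ j * g x (?e j) (?e i)))"
    by (intro sum.cong refl, subst tangent_of_basis_expansion[OF c]) (use e in \<open>simp add: metric_sum\<close>)
  also have "\<dots> = (\<Sum>i\<in>UNIV. u $ i * (\<Sum>j\<in>UNIV. u $ j * g x (?e i) (?e j)))"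
    by (intro sum.cong refl arg_cong2[where f = "(*)"] metric_sym e)
  also have "\<dots> = chart_form c (coord c x) u"
    using c by (simp add: chart_form_def metric_matrix_def Let_def sum_distrib_left charts_at_iff)
  finally show ?thesis .
qed

lemma tnorm_chart:
  assumes "c \<in> charts_at A x" "v \<in> tangent_space A x"
  shows "tnorm g x v = sqrt (chart_form c (coord c x) (v c))"
  using metric_chart[OF assms(1), of "v c"] tangent_of_coord[OF assms] by (simp add: tnorm_def)

lemma chart_form_pos:
  assumes c: "c \<in> A" "y \<in> coord c ` cdom c" and "u \<noteq> 0"
  shows "chart_form c y u > 0"
proof -
  obtain x where x: "x \<in> cdom c" "y = coord c x" using c by blast
  have cx: "c \<in> charts_at A x" using c x by (simp add: charts_at_iff)
  have "tangent_of A c x u \<noteq> (\<lambda>c. 0)"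
    using tangent_of_same[OF cx, of u] \<open>u \<noteq> 0\<close> by metis
  then show ?thesis
    using metric_pos[OF tangent_of_in[OF cx]] metric_chart[OF cx] x by metis
qed

lemma chart_form_scale: "chart_form c y (k *\<^sub>R u) = k\<^sup>2 * chart_form c y u"
  by (simp add: chart_form_def sum_distrib_left power2_eq_square algebra_simps)

lemma continuous_on_chart_form:
  assumes c: "c \<in> A" and f: "continuous_on S f" and h: "continuous_on S h"
    and S: "\<And>s. s \<in> S \<Longrightarrow> f s \<in> coord c ` cdom c"
  shows "continuous_on S (\<lambda>s. chart_form c (f s) (h s))"
proof -
  have "continuous_on S (\<lambda>s. metric_matrix A g c (f s) $ i $ j)" for i j
    using continuous_on_compose2[OF smooth_on_imp_continuous_on[OF metric_matrix_smooth[OF c]] f] S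
    by blast
  then show ?thesis
    using continuous_on_component[OF h] unfolding chart_form_def by (intro continuous_on_sum continuous_on_mult)
qed

text \<open>The constants are the extreme values of a positive continuous function on the compact
  product of \<open>K\<close> with the unit sphere; homogeneity extends the bounds from unit vectors
  to all vectors.\<close>

lemma chart_form_bounds:
  assumes c: "c \<in> A" and K: "compact K" "K \<subseteq> coord c ` cdom c"
  obtains m M where "0 < m" "0 < M"
    "\<And>y u. y \<in> K \<Longrightarrow> m * norm u \<le> sqrt (chart_form c y u)"
    "\<And>y u. y \<in> K \<Longrightarrow> sqrt (chart_form c y u) \<le> M * norm u"
proof (cases "K = {}")
  case True
  then show ?thesis using that[of 1 1] by simp
next
  case False
  let ?S = "K \<times> sphere (0::real^'n) 1"
  let ?h = "\<lambda>p. sqrt (chart_form c (fst p) (snd p))"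
  have "axis undefined 1 \<in> sphere (0::real^'n) 1" by (simp add: norm_axis_1)
  then have ne: "?S \<noteq> {}" using False by blast
  have cmp: "compact ?S" using K by (intro compact_Times) auto
  have cont: "continuous_on ?S ?h"
    by (intro continuous_intros continuous_on_chart_form c) (use K in auto)
  obtain p where p: "p \<in> ?S" "\<And>q. q \<in> ?S \<Longrightarrow> ?h p \<le> ?h q"
    using continuous_attains_inf[OF cmp ne cont] by blast
  obtain r where r: "r \<in> ?S" "\<And>q. q \<in> ?S \<Longrightarrow> ?h q \<le> ?h r"
    using continuous_attains_sup[OF cmp ne cont] by blast
  have pos: "?h q > 0" if "q \<in> ?S" for q
  proof -
    have "fst q \<in> coord c ` cdom c" "snd q \<noteq> 0" using that K(2) by auto
    then show ?thesis using chart_form_pos[OF c] by simp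
  qed
  have unit: "sqrt (chart_form c y u) = norm u * ?h (y, u /\<^sub>R norm u)" if "u \<noteq> 0" for y u
  proof -
    have "u = norm u *\<^sub>R (u /\<^sub>R norm u)" using that by simp
    then have "chart_form c y u = (norm u)\<^sup>2 * chart_form c y (u /\<^sub>R norm u)"
      by (metis chart_form_scale)
    then show ?thesis by (simp add: real_sqrt_mult)
  qed
  show ?thesis
  proof (rule that[of "?h p" "?h r"])
    fix y u assume y: "y \<in> K"
    have z: "chart_form c y 0 = 0" by (simp add: chart_form_def)
    show "?h p * norm u \<le> sqrt (chart_form c y u)"
    proof (cases "u = 0")
      case False
      then have "?h p \<le> ?h (y, u /\<^sub>R norm u)" using y by (intro p) simp
      then show ?thesis
        by (simp only: unit[OF False] mult.commute[of _ "norm u"] mult_left_mono[OF _ norm_ge_zero])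
    qed (simp add: z)
    show "sqrt (chart_form c y u) \<le> ?h r * norm u"
    proof (cases "u = 0")
      case False
      then have "?h (y, u /\<^sub>R norm u) \<le> ?h r" using y by (intro r) simp
      then show ?thesis
        by (simp only: unit[OF False] mult.commute[of _ "norm u"] mult_left_mono[OF _ norm_ge_zero])
    qed (simp add: z)
  qed (use pos p r in auto)
qed

text \<open>Membership in the tangent space matters: \<open>sqrt\<close> of a negative number is
  negative, and positivity of \<open>g\<close> is given for tangent vectors only.\<close>

lemma tnorm_nonneg: "v \<in> tangent_space A x \<Longrightarrow> tnorm g x v \<ge> 0"
  using metric_pos[of v x] metric_scale[OF tangent_space_zero tangent_space_zero, of x 0]
  unfolding tnorm_def by (cases "v = (\<lambda>c. 0)") (auto intro: less_imp_le)

lemma tnorm_scale: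
  assumes "v \<in> tangent_space A x"
  shows "tnorm g x (\<lambda>c. k *\<^sub>R v c) = \<bar>k\<bar> * tnorm g x v"
proof -
  obtain c where c: "c \<in> charts_at A x" using chart_exists charts_at_iff by blast
  show ?thesis
    using tnorm_chart[OF c tangent_space_scale[OF assms]] tnorm_chart[OF c assms]
    by (simp add: chart_form_scale real_sqrt_mult)
qed

end

section \<open>Piecewise smooth curves and their length\<close>

context atlas begin

section \<open>Velocities under restriction, change of curve and affine reparametrization\<close>

lemma has_velocity_unique_chart:
  "has_velocity A \<gamma> v t UNIV \<Longrightarrow> velocity A \<gamma> UNIV t = v"
  unfolding has_velocity_def velocity_def
  by (auto simp: fun_eq_iff tangent_space_outside vector_derivative_at)

lemma has_velocity_subset:
  "has_velocity A \<gamma> v t I \<Longrightarrow> J \<subseteq> I \<Longrightarrow> has_velocity A \<gamma> v t J"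
  unfolding has_velocity_def by (auto intro: has_vector_derivative_within_subset)

lemma has_velocity_cong:
  assumes "has_velocity A \<gamma> v t I" "t \<in> I" "\<And>s. s \<in> I \<Longrightarrow> \<gamma>' s = \<gamma> s"
  shows "has_velocity A \<gamma>' v t I"
  unfolding has_velocity_def
proof (intro conjI ballI)
  show "v \<in> tangent_space A (\<gamma>' t)" using assms by (simp add: has_velocity_def)
  fix c assume "c \<in> charts_at A (\<gamma>' t)"
  then have "((coord c \<circ> \<gamma>) has_vector_derivative v c) (at t within I)"
    using assms by (simp add: has_velocity_def)
  then show "((coord c \<circ> \<gamma>') has_vector_derivative v c) (at t within I)"
    by (rule has_vector_derivative_transform[OF assms(2), rotated]) (simp add: assms(3))
qed

lemma has_velocity_local:
  assumes "has_velocity A \<gamma> v t UNIV" "open S" "t \<in> S" "\<And>s. s \<in> S \<Longrightarrow> \<gamma>' s = \<gamma> s"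
  shows "has_velocity A \<gamma>' v t UNIV"
  unfolding has_velocity_def
proof (intro conjI ballI)
  show "v \<in> tangent_space A (\<gamma>' t)" using assms by (simp add: has_velocity_def)
  fix c assume "c \<in> charts_at A (\<gamma>' t)"
  then have "((coord c \<circ> \<gamma>) has_vector_derivative v c) (at t)"
    using assms by (simp add: has_velocity_def)
  then show "((coord c \<circ> \<gamma>') has_vector_derivative v c) (at t)"
    by (rule has_vector_derivative_transform_within_open[OF _ assms(2,3)]) (simp add: assms(4))
qed

lemma has_velocity_affine:
  fixes m k :: real
  assumes "has_velocity A \<gamma> v (m * t + k) ((\<lambda>s. m * s + k) ` I)"
  shows "has_velocity A (\<lambda>s. \<gamma> (m * s + k)) (\<lambda>c. m *\<^sub>R v c) t I"
  unfolding has_velocity_def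
proof (intro conjI ballI)
  show "(\<lambda>c. m *\<^sub>R v c) \<in> tangent_space A (\<gamma> (m * t + k))"
    using assms by (auto simp: has_velocity_def intro: tangent_space_scale)
  fix c assume "c \<in> charts_at A (\<gamma> (m * t + k))"
  then have D: "((coord c \<circ> \<gamma>) has_vector_derivative v c)
      (at (m * t + k) within (\<lambda>s. m * s + k) ` I)"
    using assms by (simp add: has_velocity_def)
  have "((\<lambda>s. m * s + k) has_vector_derivative m) (at t within I)"
    by (auto intro!: derivative_eq_intros simp: has_vector_derivative_def)
  from vector_diff_chain_within[OF this D]
  show "((coord c \<circ> (\<lambda>s. \<gamma> (m * s + k))) has_vector_derivative m *\<^sub>R v c) (at t within I)"
    by (simp add: o_def)
qed

lemma C1_curve_on_cong:
  assumes "C1_curve_on A \<gamma> I" "\<And>s. s \<in> I \<Longrightarrow> \<gamma>' s = \<gamma> s"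
  shows "C1_curve_on A \<gamma>' I"
proof -
  obtain W where W: "\<forall>t\<in>I. has_velocity A \<gamma> (W t) t I"
    "\<forall>c\<in>A. continuous_on {t\<in>I. \<gamma> t \<in> cdom c} (\<lambda>t. W t c)" and "continuous_on I \<gamma>"
    using assms(1) unfolding C1_curve_on_def by blast
  have "continuous_on I \<gamma>'"
    using \<open>continuous_on I \<gamma>\<close> assms(2) continuous_on_cong by metis
  moreover have "\<forall>t\<in>I. has_velocity A \<gamma>' (W t) t I"
    using W(1) assms(2) has_velocity_cong by blast
  moreover have "{t\<in>I. \<gamma>' t \<in> cdom c} = {t\<in>I. \<gamma> t \<in> cdom c}" for c :: "('m, 'n) chart"
    using assms(2) by auto
  ultimately show ?thesis unfolding C1_curve_on_def using W(2) by metis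
qed

lemma C1_curve_on_subset:
  assumes "C1_curve_on A \<gamma> I" "J \<subseteq> I"
  shows "C1_curve_on A \<gamma> J"
proof -
  obtain W where W: "\<forall>t\<in>I. has_velocity A \<gamma> (W t) t I"
    "\<forall>c\<in>A. continuous_on {t\<in>I. \<gamma> t \<in> cdom c} (\<lambda>t. W t c)" and "continuous_on I \<gamma>"
    using assms(1) unfolding C1_curve_on_def by blast
  have "continuous_on {t\<in>J. \<gamma> t \<in> cdom c} (\<lambda>t. W t c)" if "c \<in> A" for c
    using W(2) that assms(2) by (auto elim!: continuous_on_subset)
  moreover have "\<forall>t\<in>J. has_velocity A \<gamma> (W t) t J"
    using W(1) assms(2) has_velocity_subset by blast
  moreover have "continuous_on J \<gamma>" using \<open>continuous_on I \<gamma>\<close> assms(2) continuous_on_subset by blast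
  ultimately show ?thesis unfolding C1_curve_on_def by blast
qed

lemma C1_curve_on_affine:
  fixes m k :: real
  assumes "C1_curve_on A \<gamma> ((\<lambda>s. m * s + k) ` I)"
  shows "C1_curve_on A (\<lambda>s. \<gamma> (m * s + k)) I"
proof -
  let ?\<phi> = "\<lambda>s. m * s + k"
  obtain W where W: "\<forall>t\<in>?\<phi> ` I. has_velocity A \<gamma> (W t) t (?\<phi> ` I)"
    "\<forall>c\<in>A. continuous_on {t\<in>?\<phi> ` I. \<gamma> t \<in> cdom c} (\<lambda>t. W t c)" and c: "continuous_on (?\<phi> ` I) \<gamma>"
    using assms(1) unfolding C1_curve_on_def by blast
  have \<phi>: "continuous_on J ?\<phi>" for J by (intro continuous_intros)
  have "continuous_on I (\<lambda>s. \<gamma> (?\<phi> s))" by (rule continuous_on_compose2[OF c \<phi>]) auto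
  moreover have "\<forall>t\<in>I. has_velocity A (\<lambda>s. \<gamma> (?\<phi> s)) (\<lambda>c. m *\<^sub>R W (?\<phi> t) c) t I"
    using W(1) by (intro ballI has_velocity_affine) auto
  moreover have "continuous_on {t\<in>I. \<gamma> (?\<phi> t) \<in> cdom c} (\<lambda>t. m *\<^sub>R W (?\<phi> t) c)" if "c \<in> A" for c
    by (intro continuous_intros continuous_on_compose2[OF W(2)[rule_format, OF that] \<phi>]) auto
  ultimately show ?thesis unfolding C1_curve_on_def by (intro conjI exI) auto
qed

text \<open>The condition of \<open>piecewise_C1_curve\<close> on an arbitrary interval. Cutting,
  shifting and concatenating leave the unit interval, and \<open>pw_C1_affine\<close> returns to
  it.\<close>

definition pw_C1 :: "(real \<Rightarrow> 'm) \<Rightarrow> real \<Rightarrow> real \<Rightarrow> bool" where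
  "pw_C1 \<gamma> a b \<longleftrightarrow> continuous_on {a..b} \<gamma> \<and>
     (\<exists>P. finite P \<and> (\<forall>c d. a \<le> c \<and> c < d \<and> d \<le> b \<and> {c<..<d} \<inter> P = {} \<longrightarrow>
        C1_curve_on A \<gamma> {c..d}))"

lemma pw_C1_01: "pw_C1 \<gamma> 0 1 \<longleftrightarrow> piecewise_C1_curve A \<gamma>"
  by (simp add: pw_C1_def piecewise_C1_curve_def)

lemma pw_C1_subinterval: "pw_C1 \<gamma> a b \<Longrightarrow> a \<le> c \<Longrightarrow> d \<le> b \<Longrightarrow> pw_C1 \<gamma> c d"
  unfolding pw_C1_def by (meson atLeastatMost_subset_iff continuous_on_subset order_trans)

lemma C1_imp_pw_C1: "C1_curve_on A \<gamma> {a..b} \<Longrightarrow> pw_C1 \<gamma> a b"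
  unfolding pw_C1_def
  by (intro conjI exI[of _ "{}"] allI impI)
     (simp add: C1_curve_on_def, simp, rule C1_curve_on_subset, assumption, simp)

lemma pw_C1_affine:
  assumes "pw_C1 \<gamma> (m * a + k) (m * b + k)" "0 < m"
  shows "pw_C1 (\<lambda>s. \<gamma> (m * s + k)) a b"
proof -
  let ?\<phi> = "\<lambda>s. m * s + k"
  obtain P where P: "finite P" "\<And>c d. ?\<phi> a \<le> c \<Longrightarrow> c < d \<Longrightarrow> d \<le> ?\<phi> b \<Longrightarrow> {c<..<d} \<inter> P = {} \<Longrightarrow>
      C1_curve_on A \<gamma> {c..d}" and c: "continuous_on {?\<phi> a..?\<phi> b} \<gamma>"
    using assms(1) unfolding pw_C1_def by blast
  have img: "?\<phi> ` {c..d} = {?\<phi> c..?\<phi> d}" if "c \<le> d" for c d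
    using that assms(2) by (simp add: image_affinity_atLeastAtMost)
  have sub: "?\<phi> ` {a..b} \<subseteq> {?\<phi> a..?\<phi> b}" using assms(2) by auto
  have "continuous_on {a..b} (\<lambda>s. \<gamma> (?\<phi> s))"
    by (rule continuous_on_compose2[OF c _ sub]) (intro continuous_intros)
  moreover have fin: "finite (?\<phi> -` P)"
    using assms(2) by (intro finite_vimageI P) (auto simp: inj_on_def)
  moreover have "C1_curve_on A (\<lambda>s. \<gamma> (?\<phi> s)) {c..d}"
    if cd: "a \<le> c" "c < d" "d \<le> b" "{c<..<d} \<inter> ?\<phi> -` P = {}" for c d
  proof (rule C1_curve_on_affine, subst img)
    show "C1_curve_on A \<gamma> {?\<phi> c..?\<phi> d}"
    proof (rule P(2))
      have "s \<notin> P" if s: "s \<in> {?\<phi> c<..<?\<phi> d}" for s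
      proof -
        have "(s - k) / m \<in> {c<..<d}" "?\<phi> ((s - k) / m) = s"
          using s assms(2) by (auto simp: field_simps)
        then show ?thesis using cd(4) by (metis IntI empty_iff vimageI)
      qed
      then show "{?\<phi> c<..<?\<phi> d} \<inter> P = {}" by blast
    qed (use cd assms(2) in auto)
  qed (use cd in auto)
  ultimately show ?thesis
    unfolding pw_C1_def
    by (intro conjI exI[of _ "?\<phi> -` P"] allI impI) (assumption | elim conjE)+
qed

lemma pw_C1_reverse:
  assumes "pw_C1 \<gamma> a b"
  shows "pw_C1 (\<lambda>s. \<gamma> (- s)) (- b) (- a)"
proof -
  obtain P where P: "finite P" "\<And>c d. a \<le> c \<Longrightarrow> c < d \<Longrightarrow> d \<le> b \<Longrightarrow> {c<..<d} \<inter> P = {} \<Longrightarrow>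
      C1_curve_on A \<gamma> {c..d}" and c: "continuous_on {a..b} \<gamma>"
    using assms(1) unfolding pw_C1_def by blast
  have "continuous_on {-b..-a} (\<lambda>s. \<gamma> (- s))"
    by (rule continuous_on_compose2[OF c]) (auto intro!: continuous_intros)
  moreover have "C1_curve_on A (\<lambda>s. \<gamma> (- s)) {c..d}"
    if cd: "- b \<le> c" "c < d" "d \<le> - a" "{c<..<d} \<inter> uminus ` P = {}" for c d
  proof -
    have "C1_curve_on A \<gamma> {-d..-c}"
    proof (rule P(2))
      show "{-d<..<-c} \<inter> P = {}"
      proof (rule ccontr)
        assume "{-d<..<-c} \<inter> P \<noteq> {}"
        then obtain p where "p \<in> P" "-d < p" "p < -c" by auto
        then have "- p \<in> {c<..<d} \<inter> uminus ` P" by auto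
        then show False using cd(4) by blast
      qed
    qed (use cd in auto)
    then show ?thesis
      using C1_curve_on_affine[of \<gamma> "-1" 0 "{c..d}"] by simp
  qed
  ultimately show ?thesis
    unfolding pw_C1_def using finite_imageI[OF P(1), of uminus]
    by (intro conjI exI[of _ "uminus ` P"] allI impI) (assumption | elim conjE)+
qed

lemma pw_C1_join:
  assumes 1: "pw_C1 \<gamma>\<^sub>1 a b" and 2: "pw_C1 \<gamma>\<^sub>2 b c" and "\<gamma>\<^sub>1 b = \<gamma>\<^sub>2 b" "a \<le> b" "b \<le> c"
  shows "pw_C1 (\<lambda>t. if t \<le> b then \<gamma>\<^sub>1 t else \<gamma>\<^sub>2 t) a c"
proof -
  let ?\<gamma> = "\<lambda>t. if t \<le> b then \<gamma>\<^sub>1 t else \<gamma>\<^sub>2 t"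
  obtain P1 where P1: "finite P1" "\<And>p q. a \<le> p \<Longrightarrow> p < q \<Longrightarrow> q \<le> b \<Longrightarrow> {p<..<q} \<inter> P1 = {} \<Longrightarrow>
      C1_curve_on A \<gamma>\<^sub>1 {p..q}" and c1: "continuous_on {a..b} \<gamma>\<^sub>1"
    using 1 unfolding pw_C1_def by blast
  obtain P2 where P2: "finite P2" "\<And>p q. b \<le> p \<Longrightarrow> p < q \<Longrightarrow> q \<le> c \<Longrightarrow> {p<..<q} \<inter> P2 = {} \<Longrightarrow>
      C1_curve_on A \<gamma>\<^sub>2 {p..q}" and c2: "continuous_on {b..c} \<gamma>\<^sub>2"
    using 2 unfolding pw_C1_def by blast
  have ac: "{a..c} = {a..b} \<union> {b..c}" using assms by auto
  have "continuous_on {a..c} ?\<gamma>"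
    unfolding ac by (rule continuous_on_cases) (use c1 c2 assms in auto)
  \<comment> \<open>The junction \<open>b\<close> joins the exceptional set, so that no admissible
    interval straddles it; the one-sided velocities there may differ.\<close>
  moreover have "C1_curve_on A ?\<gamma> {p..q}"
    if pq: "a \<le> p" "p < q" "q \<le> c" "{p<..<q} \<inter> (insert b (P1 \<union> P2)) = {}" for p q
  proof (cases "q \<le> b")
    case True
    then have "C1_curve_on A \<gamma>\<^sub>1 {p..q}" using pq by (intro P1) auto
    then show ?thesis by (rule C1_curve_on_cong) (use True in auto)
  next
    case False
    have "b \<notin> {p<..<q}" using pq(4) by blast
    then have bp: "b \<le> p" using False by auto
    then have "C1_curve_on A \<gamma>\<^sub>2 {p..q}" using pq by (intro P2) auto
    then show ?thesis
    proof (rule C1_curve_on_cong)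
      fix s assume "s \<in> {p..q}"
      then show "?\<gamma> s = \<gamma>\<^sub>2 s" using bp assms(3) by (cases "s = b") auto
    qed
  qed
  ultimately show ?thesis
    unfolding pw_C1_def using P1(1) P2(1)
    by (intro conjI exI[of _ "insert b (P1 \<union> P2)"] allI impI) (simp | elim conjE)+
qed

text \<open>Away from the partition, a closed interval around \<open>t\<close> lies in one smooth
  piece, and at its interior point \<open>t\<close> the derivative within it is the two-sided one.
  The finite exceptional set is invisible to the integrals below.\<close>

lemma pw_C1_velocity:
  assumes "pw_C1 \<gamma> a b"
  obtains P where "finite P" "\<And>t. t \<in> {a<..<b} - P \<Longrightarrow> \<exists>v. has_velocity A \<gamma> v t UNIV"
proof -
  obtain P where P: "finite P" "\<And>c d. a \<le> c \<Longrightarrow> c < d \<Longrightarrow> d \<le> b \<Longrightarrow> {c<..<d} \<inter> P = {} \<Longrightarrow>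
      C1_curve_on A \<gamma> {c..d}"
    using assms(1) unfolding pw_C1_def by blast
  have "\<exists>v. has_velocity A \<gamma> v t UNIV" if t: "t \<in> {a<..<b} - P" for t
  proof -
    have "open ({a<..<b} - P)" using P(1) by (simp add: finite_imp_closed open_Diff)
    then obtain e where e: "e > 0" "cball t e \<subseteq> {a<..<b} - P"
      using t open_contains_cball by blast
    then have sub: "{t-e..t+e} \<subseteq> {a<..<b} - P" by (simp add: cball_eq_atLeastAtMost)
    have "C1_curve_on A \<gamma> {t-e..t+e}"
    proof (rule P(2))
      show "{t-e<..<t+e} \<inter> P = {}" using sub greaterThanLessThan_subseteq_atLeastAtMost_iff by blast
      have "t - e \<in> {a<..<b}" "t + e \<in> {a<..<b}" using sub e(1) by (auto simp: subset_iff)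
      then show "a \<le> t - e" "t + e \<le> b" by auto
    qed (use e(1) in auto)
    moreover have "t \<in> {t-e..t+e}" using e(1) by simp
    ultimately obtain v where "has_velocity A \<gamma> v t {t-e..t+e}"
      unfolding C1_curve_on_def by blast
    then have "has_velocity A \<gamma> v t UNIV"
      using \<open>e > 0\<close> unfolding has_velocity_def by (simp add: at_within_Icc_at)
    then show ?thesis by blast
  qed
  then show ?thesis using that P(1) by blast
qed

text \<open>Coordinate segments are the test curves for upper bounds on the distance. Their velocity
  is constant in \<open>c\<close>; its continuity in another chart is that of the derivative of the
  transition map.\<close>

lemma C1_segment:
  assumes c: "c \<in> A" and I: "\<And>t. t \<in> I \<Longrightarrow> y + t *\<^sub>R u \<in> coord c ` cdom c"
  defines "\<gamma> \<equiv> \<lambda>t. coord_inv c (y + t *\<^sub>R u)"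
  shows "C1_curve_on A \<gamma> I"
    and "t \<in> I \<Longrightarrow> has_velocity A \<gamma> (tangent_of A c (\<gamma> t) u) t I"
proof -
  have l: "continuous_on J (\<lambda>t::real. y + t *\<^sub>R u)" for J by (intro continuous_intros)
  have cont: "continuous_on I \<gamma>"
    unfolding \<gamma>_def by (rule continuous_on_compose2[OF continuous_on_coord_inv[OF c] l]) (use I in auto)
  have \<gamma>: "\<gamma> t \<in> cdom c" "coord c (\<gamma> t) = y + t *\<^sub>R u" if "t \<in> I" for t
    using I[OF that] c by (auto simp: \<gamma>_def)
  then have ch: "c \<in> charts_at A (\<gamma> t)" if "t \<in> I" for t using c that by (simp add: charts_at_iff)
  show vel: "has_velocity A \<gamma> (tangent_of A c (\<gamma> t) u) t I" if t: "t \<in> I" for t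
  proof (subst has_velocity_iff_chart[OF ch[OF t] t cont tangent_of_in[OF ch[OF t]]])
    have "((\<lambda>t. y + t *\<^sub>R u) has_vector_derivative u) (at t within I)"
      by (auto intro!: derivative_eq_intros)
    then have "((coord c \<circ> \<gamma>) has_vector_derivative u) (at t within I)"
      by (rule has_vector_derivative_transform[OF t, rotated]) (use \<gamma> in auto)
    then show "((coord c \<circ> \<gamma>) has_vector_derivative tangent_of A c (\<gamma> t) u c) (at t within I)"
      by (simp add: tangent_of_same[OF ch[OF t]])
  qed
  have "continuous_on {t\<in>I. \<gamma> t \<in> cdom d} (\<lambda>t. tangent_of A c (\<gamma> t) u d)" if d: "d \<in> A" for d
  proof -
    have "continuous_on {t\<in>I. \<gamma> t \<in> cdom d}
        (\<lambda>t. frechet_derivative (coord d \<circ> coord_inv c) (at (y + t *\<^sub>R u)) u)"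
      by (rule continuous_on_compose2[OF smooth_on_continuous_derivative[OF transition_smooth[OF c d]] l])
         (use \<gamma> in \<open>force simp: image_iff\<close>)
    then show ?thesis
      by (rule continuous_on_eq)
         (use \<gamma> d ch in \<open>auto simp: tangent_of_def transition_deriv_def charts_at_iff\<close>)
  qed
  then show "C1_curve_on A \<gamma> I"
    unfolding C1_curve_on_def using cont vel by (intro conjI exI[of _ "\<lambda>t. tangent_of A c (\<gamma> t) u"]) auto
qed

end

context riemannian begin

text \<open>The two-sided speed, which unlike the integrand of \<^const>\<open>curve_length\<close> does not refer to
  an interval and is never negative; the two agree up to a finite set.\<close>

definition speed :: "(real \<Rightarrow> 'm) \<Rightarrow> real \<Rightarrow> real" where
  "speed \<gamma> t = (if has_velocity A \<gamma> (velocity A \<gamma> UNIV t) t UNIV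
     then tnorm g (\<gamma> t) (velocity A \<gamma> UNIV t) else 0)"

definition len :: "(real \<Rightarrow> 'm) \<Rightarrow> real \<Rightarrow> real \<Rightarrow> real" where
  "len \<gamma> a b = integral {a..b} (speed \<gamma>)"

section \<open>Integrability, additivity and reparametrization of length\<close>

lemma speed_eq: "has_velocity A \<gamma> v t UNIV \<Longrightarrow> speed \<gamma> t = tnorm g (\<gamma> t) v"
  using has_velocity_unique_chart[of \<gamma> v t] by (simp add: speed_def)

lemma speed_nonneg: "speed \<gamma> t \<ge> 0"
  by (simp add: speed_def has_velocity_def tnorm_nonneg)

lemma speed_no_velocity: "\<nexists>v. has_velocity A \<gamma> v t UNIV \<Longrightarrow> speed \<gamma> t = 0"
  by (simp add: speed_def)

lemma speed_local:
  assumes "open S" "t \<in> S" "\<And>s. s \<in> S \<Longrightarrow> \<gamma>' s = \<gamma> s"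
  shows "speed \<gamma>' t = speed \<gamma> t"
proof (cases "\<exists>v. has_velocity A \<gamma> v t UNIV")
  case True
  then obtain v where v: "has_velocity A \<gamma> v t UNIV" by blast
  show ?thesis
    using speed_eq[OF v] speed_eq[OF has_velocity_local[OF v assms]] assms by simp
next
  case False
  then have "\<nexists>v. has_velocity A \<gamma>' v t UNIV"
    using has_velocity_local[OF _ assms(1,2), of \<gamma>' _ \<gamma>] assms(3) by metis
  then show ?thesis using False by (simp add: speed_no_velocity)
qed

lemma speed_affine:
  fixes m k :: real
  assumes "m \<noteq> 0"
  shows "speed (\<lambda>s. \<gamma> (m * s + k)) t = \<bar>m\<bar> * speed \<gamma> (m * t + k)"
proof (cases "\<exists>v. has_velocity A \<gamma> v (m * t + k) UNIV")
  case True
  then obtain v where v: "has_velocity A \<gamma> v (m * t + k) UNIV" by blast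
  then have "has_velocity A (\<lambda>s. \<gamma> (m * s + k)) (\<lambda>c. m *\<^sub>R v c) t UNIV"
    by (intro has_velocity_affine) (auto intro: has_velocity_subset)
  from speed_eq[OF this] speed_eq[OF v] v show ?thesis
    by (simp add: tnorm_scale has_velocity_def)
next
  \<comment> \<open>Both sides are then the default value 0: a velocity of the reparametrized curve
    would be carried back by the inverse affine map to one of the original curve.\<close>
  case False
  have "\<nexists>v. has_velocity A (\<lambda>s. \<gamma> (m * s + k)) v t UNIV"
  proof
    assume "\<exists>v. has_velocity A (\<lambda>s. \<gamma> (m * s + k)) v t UNIV"
    then obtain v where v: "has_velocity A (\<lambda>s. \<gamma> (m * s + k)) v t UNIV" by blast
    have t: "(1/m) * (m * t + k) + (- k / m) = t" using assms by (simp add: field_simps)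
    have "has_velocity A (\<lambda>s. \<gamma> (m * ((1/m) * s + (- k / m)) + k)) (\<lambda>c. (1/m) *\<^sub>R v c) (m * t + k) UNIV"
      by (rule has_velocity_affine[where \<gamma> = "\<lambda>s. \<gamma> (m * s + k)"], subst t) (rule has_velocity_subset[OF v], simp)
    moreover have "m * ((1/m) * s + (- k / m)) + k = s" for s using assms by (simp add: field_simps)
    ultimately show False using False by simp
  qed
  then show ?thesis using False by (simp add: speed_no_velocity)
qed

lemma C1_speed_integrable:
  assumes C: "C1_curve_on A \<gamma> {a..b}"
  shows "speed \<gamma> integrable_on {a..b}"
proof -
  let ?I = "{a..b}"
  obtain W where W: "\<And>t. t \<in> ?I \<Longrightarrow> has_velocity A \<gamma> (W t) t ?I"
    "\<And>c. c \<in> A \<Longrightarrow> continuous_on {t\<in>?I. \<gamma> t \<in> cdom c} (\<lambda>t. W t c)" and cont: "continuous_on ?I \<gamma>"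
    using C unfolding C1_curve_on_def by blast
  have tan: "W t \<in> tangent_space A (\<gamma> t)" if "t \<in> ?I" for t
    using W(1)[OF that] by (simp add: has_velocity_def)
  have "continuous_on ?I (\<lambda>t. tnorm g (\<gamma> t) (W t))"
    unfolding continuous_on_eq_continuous_within
  proof
    fix t assume t: "t \<in> ?I"
    obtain c where c: "c \<in> A" "\<gamma> t \<in> cdom c" using chart_exists by blast
    let ?J = "{t\<in>?I. \<gamma> t \<in> cdom c}"
    have J: "continuous_on ?J \<gamma>" using cont by (rule continuous_on_subset) auto
    have "continuous_on ?J (\<lambda>t. sqrt (chart_form c (coord c (\<gamma> t)) (W t c)))"
      by (intro continuous_intros continuous_on_chart_form c W
          continuous_on_compose2[OF continuous_on_coord[OF c(1)] J]) auto
    then have "continuous_on ?J (\<lambda>t. tnorm g (\<gamma> t) (W t))"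
      by (rule continuous_on_eq) (use c tan in \<open>auto simp: charts_at_iff intro!: tnorm_chart[symmetric]\<close>)
    then have "continuous (at t within ?J) (\<lambda>t. tnorm g (\<gamma> t) (W t))"
      using t c by (simp add: continuous_on_eq_continuous_within)
    moreover obtain U where U: "open U" "U \<inter> ?I = \<gamma> -` cdom c \<inter> ?I"
      using cont open_cdom[OF c(1)] continuous_on_open_invariant by metis
    \<comment> \<open>The coordinate formula for the norm is available only while the curve is in
      the chart. These times form a relatively open set, so continuity within it at \<open>t\<close>
      is continuity within \<open>?I\<close>.\<close>
    moreover have "at t within ?I = at t within ?J"
    proof (rule at_within_nhd)
      show "t \<in> U" "open U" "?I \<inter> U - {t} = ?J \<inter> U - {t}" using U t c by blast+
    qed
    ultimately show "continuous (at t within ?I) (\<lambda>t. tnorm g (\<gamma> t) (W t))" by simp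
  qed
  then have int: "(\<lambda>t. tnorm g (\<gamma> t) (W t)) integrable_on ?I" by (rule integrable_continuous_interval)
  show ?thesis
  proof (rule integrable_spike_finite[OF _ _ int])
    show "finite {a, b}" by simp
    fix t assume t: "t \<in> ?I - {a, b}"
    then have "has_velocity A \<gamma> (W t) t UNIV"
      using W(1)[of t] unfolding has_velocity_def by (simp add: at_within_Icc_at)
    then show "speed \<gamma> t = tnorm g (\<gamma> t) (W t)" by (rule speed_eq)
  qed
qed

lemma speed_integrable:
  assumes "pw_C1 \<gamma> a b"
  shows "speed \<gamma> integrable_on {a..b}"
proof -
  obtain P where P: "finite P" "\<And>c d. a \<le> c \<Longrightarrow> c < d \<Longrightarrow> d \<le> b \<Longrightarrow> {c<..<d} \<inter> P = {} \<Longrightarrow>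
      C1_curve_on A \<gamma> {c..d}"
    using assms(1) unfolding pw_C1_def by blast
  have "speed \<gamma> integrable_on {c..d}" if "a \<le> c" "d \<le> b" for c d
    using that
  proof (induction "card ({c<..<d} \<inter> P)" arbitrary: c d rule: less_induct)
    case less
    show ?case
    proof (cases "c < d")
      case True
      show ?thesis
      proof (cases "{c<..<d} \<inter> P = {}")
        case True
        then show ?thesis using P(2) less.prems \<open>c < d\<close> C1_speed_integrable by blast
      next
        case False
        then obtain p where p: "p \<in> {c<..<d}" "p \<in> P" by blast
        have "{c<..<p} \<inter> P \<subset> {c<..<d} \<inter> P" "{p<..<d} \<inter> P \<subset> {c<..<d} \<inter> P" using p by auto
        then have "card ({c<..<p} \<inter> P) < card ({c<..<d} \<inter> P)" "card ({p<..<d} \<inter> P) < card ({c<..<d} \<inter> P)"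
          using P(1) by (auto intro: psubset_card_mono)
        then have "speed \<gamma> integrable_on {c..p}" "speed \<gamma> integrable_on {p..d}"
          using less p by auto
        then show ?thesis
          using p Henstock_Kurzweil_Integration.integrable_combine[of c p d] by auto
      qed
    next
      case False
      then have "{c..d} = {} \<or> {c..d} = cbox c c" by auto
      then show ?thesis by (metis integrable_on_empty integrable_on_refl)
    qed
  qed
  then show ?thesis by auto
qed

lemma len_nonneg: "pw_C1 \<gamma> a b \<Longrightarrow> len \<gamma> a b \<ge> 0"
  unfolding len_def by (intro integral_nonneg speed_integrable speed_nonneg)

lemma len_combine:
  "pw_C1 \<gamma> a c \<Longrightarrow> a \<le> b \<Longrightarrow> b \<le> c \<Longrightarrow> len \<gamma> a b + len \<gamma> b c = len \<gamma> a c"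
  unfolding len_def by (intro Henstock_Kurzweil_Integration.integral_combine speed_integrable)

lemma len_le:
  assumes "pw_C1 \<gamma> a c" "a \<le> b" "b \<le> c"
  shows "len \<gamma> a b \<le> len \<gamma> a c"
  using len_combine[OF assms] len_nonneg[OF pw_C1_subinterval[OF assms(1,2) order_refl]] by simp

lemma curve_length_eq_len:
  assumes "piecewise_C1_curve A \<gamma>"
  shows "curve_length A g \<gamma> = len \<gamma> 0 1"
proof -
  have pw: "pw_C1 \<gamma> 0 1" using assms pw_C1_01 by blast
  obtain P where P: "finite P" "\<And>t. t \<in> {0<..<1} - P \<Longrightarrow> \<exists>v. has_velocity A \<gamma> v t UNIV"
    using pw_C1_velocity[OF pw] by blast
  show ?thesis
    unfolding curve_length_def len_def
  proof (rule integral_spike)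
    show "negligible (P \<union> {0, 1})" using P(1) by (simp add: negligible_finite)
    fix t assume t: "t \<in> {0..1} - (P \<union> {0, 1})"
    then obtain v where v: "has_velocity A \<gamma> v t UNIV" using P(2)[of t] by auto
    have "at t within {0..1} = at t" by (rule at_within_Icc_at) (use t in auto)
    then have "velocity A \<gamma> {0..1} t = velocity A \<gamma> UNIV t"
      unfolding velocity_def by (rule arg_cong)
    then show "speed \<gamma> t = tnorm g (\<gamma> t) (velocity A \<gamma> {0..1} t)"
      using speed_eq[OF v] has_velocity_unique_chart[OF v] by simp
  qed
qed

lemma rdist_eq: "rdist A g x y = Inf {len \<gamma> 0 1 | \<gamma>. pw_C1 \<gamma> 0 1 \<and> \<gamma> 0 = x \<and> \<gamma> 1 = y}"
  unfolding rdist_def pw_C1_01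
  by (intro arg_cong[where f = Inf] Collect_cong ex_cong1) (auto simp: curve_length_eq_len)

text \<open>Substitution divides the integral by \<open>m\<close>, and the chain rule multiplies the
  speed by \<open>m\<close>; the two factors cancel.\<close>

lemma len_affine:
  assumes "0 < m" "a \<le> b" "pw_C1 \<gamma> (m * a + k) (m * b + k)"
  shows "len (\<lambda>s. \<gamma> (m * s + k)) a b = len \<gamma> (m * a + k) (m * b + k)"
proof -
  let ?i = "len \<gamma> (m * a + k) (m * b + k)"
  have i: "(speed \<gamma> has_integral ?i) {m * a + k..m * b + k}"
    unfolding len_def using speed_integrable[OF assms(3)] by (rule integrable_integral)
  have "(\<lambda>x. (1 / m) *\<^sub>R x + - ((1 / m) *\<^sub>R k)) ` cbox (m * a + k) (m * b + k) = {a..b}"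
    using assms image_affinity_atLeastAtMost[of "1/m" "- (1/m) * k" "m * a + k" "m * b + k"]
    by (simp add: field_simps)
  then have "((\<lambda>s. speed \<gamma> (m * s + k)) has_integral (1 / \<bar>m\<bar>) * ?i) {a..b}"
    using has_integral_affinity[of "speed \<gamma>" ?i "m * a + k" "m * b + k" m k] i assms by simp
  from has_integral_mult_right[OF this, of m]
  have "((\<lambda>s. m * speed \<gamma> (m * s + k)) has_integral ?i) {a..b}"
    using assms(1) by simp
  moreover have "speed (\<lambda>s. \<gamma> (m * s + k)) = (\<lambda>s. m * speed \<gamma> (m * s + k))"
    using assms(1) speed_affine[of m \<gamma> k] by (intro ext) simp
  ultimately have "(speed (\<lambda>s. \<gamma> (m * s + k)) has_integral ?i) {a..b}"
    by simp
  then show ?thesis unfolding len_def by (rule integral_unique)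
qed

lemma len_reverse:
  assumes "pw_C1 \<gamma> a b"
  shows "len (\<lambda>s. \<gamma> (- s)) (- b) (- a) = len \<gamma> a b"
proof -
  have "(speed \<gamma> has_integral len \<gamma> a b) {a..b}"
    unfolding len_def using speed_integrable[OF assms] by (rule integrable_integral)
  then have "((\<lambda>s. speed \<gamma> (- s)) has_integral len \<gamma> a b) {-b..-a}" by simp
  moreover have "speed (\<lambda>s. \<gamma> (- s)) = (\<lambda>s. speed \<gamma> (- s))"
    using speed_affine[of "-1" \<gamma> 0] by (simp add: fun_eq_iff)
  ultimately have "(speed (\<lambda>s. \<gamma> (- s)) has_integral len \<gamma> a b) {-b..-a}" by argo
  then show ?thesis unfolding len_def[of _ "- b"] by (rule integral_unique)
qed

text \<open>On either side of \<open>b\<close> the joined curve coincides with one of the pieces on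
  an open half-line, so the speeds agree there; the single time \<open>b\<close> is
  negligible.\<close>

lemma len_join:
  assumes "pw_C1 \<gamma>\<^sub>1 a b" "pw_C1 \<gamma>\<^sub>2 b c" "\<gamma>\<^sub>1 b = \<gamma>\<^sub>2 b" "a \<le> b" "b \<le> c"
  shows "len (\<lambda>t. if t \<le> b then \<gamma>\<^sub>1 t else \<gamma>\<^sub>2 t) a c = len \<gamma>\<^sub>1 a b + len \<gamma>\<^sub>2 b c"
proof -
  let ?\<gamma> = "\<lambda>t. if t \<le> b then \<gamma>\<^sub>1 t else \<gamma>\<^sub>2 t"
  have "len ?\<gamma> a b = len \<gamma>\<^sub>1 a b"
    unfolding len_def
  proof (rule integral_spike[of "{b}"])
    fix t assume "t \<in> {a..b} - {b}"
    then show "speed \<gamma>\<^sub>1 t = speed ?\<gamma> t" by (intro speed_local[of "{..<b}"]) auto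
  qed simp
  moreover have "len ?\<gamma> b c = len \<gamma>\<^sub>2 b c"
    unfolding len_def
  proof (rule integral_spike[of "{b}"])
    fix t assume "t \<in> {b..c} - {b}"
    then show "speed \<gamma>\<^sub>2 t = speed ?\<gamma> t" by (intro speed_local[of "{b<..}"]) auto
  qed simp
  ultimately show ?thesis
    using len_combine[OF pw_C1_join[OF assms] assms(4,5)] by simp
qed

lemma rdist_le_len:
  assumes "a < b" "pw_C1 \<gamma> a b"
  shows "rdist A g (\<gamma> a) (\<gamma> b) \<le> len \<gamma> a b"
proof -
  let ?\<gamma> = "\<lambda>s. \<gamma> ((b - a) * s + a)"
  have pw: "pw_C1 ?\<gamma> 0 1" using assms by (intro pw_C1_affine) auto
  have "len ?\<gamma> 0 1 = len \<gamma> a b"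
    using assms len_affine[of "b - a" 0 1 \<gamma> a] by simp
  show ?thesis
    unfolding rdist_eq
  proof (rule cInf_lower)
    show "len \<gamma> a b \<in> {len \<gamma>' 0 1 | \<gamma>'. pw_C1 \<gamma>' 0 1 \<and> \<gamma>' 0 = \<gamma> a \<and> \<gamma>' 1 = \<gamma> b}"
      using pw \<open>len ?\<gamma> 0 1 = len \<gamma> a b\<close> by (intro CollectI exI[of _ ?\<gamma>]) simp
    show "bdd_below {len \<gamma>' 0 1 | \<gamma>'. pw_C1 \<gamma>' 0 1 \<and> \<gamma>' 0 = \<gamma> a \<and> \<gamma>' 1 = \<gamma> b}"
      by (rule bdd_belowI[of _ 0]) (use len_nonneg in blast)
  qed
qed

end

section \<open>The Riemannian distance\<close>

context riemannian begin

text \<open>The standard local data: a closed coordinate ball inside a given neighbourhood, with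
  constants comparing the metric to the Euclidean norm on it.\<close>

lemma chart_ball:
  assumes "open U" "x \<in> U"
  obtains c r m M where "c \<in> A" "x \<in> cdom c" "0 < r"
    "cball (coord c x) r \<subseteq> coord c ` (U \<inter> cdom c)" "0 < m" "0 < M"
    "\<And>y u. y \<in> cball (coord c x) r \<Longrightarrow> m * norm u \<le> sqrt (chart_form c y u)"
    "\<And>y u. y \<in> cball (coord c x) r \<Longrightarrow> sqrt (chart_form c y u) \<le> M * norm u"
proof -
  obtain c where c: "c \<in> A" "x \<in> cdom c" using chart_exists by blast
  have "open (coord c ` (U \<inter> cdom c))"
    by (intro open_coord_image open_Int open_cdom c assms) simp
  then obtain r where r: "0 < r" "cball (coord c x) r \<subseteq> coord c ` (U \<inter> cdom c)"
    using assms c open_contains_cball by blast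
  then have "cball (coord c x) r \<subseteq> coord c ` cdom c" by blast
  with chart_form_bounds[OF c(1) compact_cball this] show ?thesis
    using that[OF c r] by metis
qed

lemma rdist_segment_le:
  assumes c: "c \<in> A" and K: "convex K" "K \<subseteq> coord c ` cdom c" "y \<in> K" "z \<in> K"
    and M: "\<And>y u. y \<in> K \<Longrightarrow> sqrt (chart_form c y u) \<le> M * norm u"
  shows "pw_C1 (\<lambda>t. coord_inv c (y + t *\<^sub>R (z - y))) 0 1"
    and "rdist A g (coord_inv c y) (coord_inv c z) \<le> M * norm (z - y)"
proof -
  let ?\<gamma> = "\<lambda>t. coord_inv c (y + t *\<^sub>R (z - y))"
  \<comment> \<open>An open set of parameters containing the unit interval, so that the velocity is
    two-sided, as \<open>speed\<close> demands, also at the end points 0 and 1.\<close>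
  let ?O = "(\<lambda>t. y + t *\<^sub>R (z - y)) -` (coord c ` cdom c)"
  have inK: "y + t *\<^sub>R (z - y) \<in> K" if "t \<in> {0..1}" for t
  proof -
    have "(1 - t) *\<^sub>R y + t *\<^sub>R z \<in> K" using K that by (intro convexD_alt) auto
    moreover have "(1 - t) *\<^sub>R y + t *\<^sub>R z = y + t *\<^sub>R (z - y)" by (simp add: algebra_simps)
    ultimately show ?thesis by simp
  qed
  have O: "open ?O"
    by (rule open_vimage[OF open_range[OF c]]) (intro continuous_intros)
  have sub: "{0..1} \<subseteq> ?O" using inK K(2) by blast
  show pw: "pw_C1 ?\<gamma> 0 1"
    by (rule C1_imp_pw_C1, rule C1_segment[OF c]) (use sub in auto)
  have "speed ?\<gamma> t \<le> M * norm (z - y)" if t: "t \<in> {0..1}" for t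
  proof -
    have tO: "t \<in> ?O" using sub t by blast
    then have ct: "c \<in> charts_at A (?\<gamma> t)" "coord c (?\<gamma> t) = y + t *\<^sub>R (z - y)"
      using c by (auto simp: charts_at_iff)
    have "has_velocity A ?\<gamma> (tangent_of A c (?\<gamma> t) (z - y)) t ?O"
      by (rule C1_segment[OF c]) (use tO in auto)
    then have "has_velocity A ?\<gamma> (tangent_of A c (?\<gamma> t) (z - y)) t UNIV"
      unfolding has_velocity_def at_within_open[OF tO O] .
    from speed_eq[OF this]
    have "speed ?\<gamma> t = sqrt (chart_form c (y + t *\<^sub>R (z - y)) (z - y))"
      using tnorm_chart[OF ct(1) tangent_of_in[OF ct(1)]] ct(2) tangent_of_same[OF ct(1)] by simp
    then show ?thesis using M[OF inK[OF t]] by simp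
  qed
  then have "len ?\<gamma> 0 1 \<le> integral {0..1} (\<lambda>t::real. M * norm (z - y))"
    unfolding len_def by (intro integral_le speed_integrable pw) auto
  then show "rdist A g (coord_inv c y) (coord_inv c z) \<le> M * norm (z - y)"
    using rdist_le_len[OF _ pw] by simp
qed

text \<open>The fundamental theorem of calculus, applied to the curve in coordinates with finitely
  many exceptional times, expresses the displacement as the integral of the coordinate velocity,
  whose norm times \<open>m\<close> is at most the speed.\<close>

lemma len_ge_in_chart:
  assumes pw: "pw_C1 \<gamma> a b" "a \<le> b" and c: "c \<in> A"
    and K: "\<And>t. t \<in> {a..b} \<Longrightarrow> \<gamma> t \<in> cdom c" "\<And>t. t \<in> {a..b} \<Longrightarrow> coord c (\<gamma> t) \<in> K"
    and m: "\<And>y u. y \<in> K \<Longrightarrow> m * norm u \<le> sqrt (chart_form c y u)"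
  shows "m * norm (coord c (\<gamma> b) - coord c (\<gamma> a)) \<le> len \<gamma> a b"
proof -
  obtain P where P: "finite P" "\<And>t. t \<in> {a<..<b} - P \<Longrightarrow> \<exists>v. has_velocity A \<gamma> v t UNIV"
    using pw_C1_velocity[OF pw(1)] by blast
  \<comment> \<open>The default 0 matches that of \<open>speed\<close>, so the pointwise bound below
    holds at every time, including the exceptional ones.\<close>
  define f' where "f' = (\<lambda>t. if \<exists>v. has_velocity A \<gamma> v t UNIV then velocity A \<gamma> UNIV t c else 0)"
  have ch: "c \<in> charts_at A (\<gamma> t)" if "t \<in> {a..b}" for t
    using K(1)[OF that] c by (simp add: charts_at_iff)
  have cont: "continuous_on {a..b} \<gamma>" using pw by (simp add: pw_C1_def)
  have f': "(f' has_integral ((coord c \<circ> \<gamma>) b - (coord c \<circ> \<gamma>) a)) {a..b}"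
  proof (rule fundamental_theorem_of_calculus_interior_strong[OF P(1) pw(2)])
    fix t assume t: "t \<in> {a<..<b} - P"
    then obtain v where v: "has_velocity A \<gamma> v t UNIV" using P by blast
    then have "((coord c \<circ> \<gamma>) has_vector_derivative v c) (at t)"
      using ch[of t] t by (simp add: has_velocity_def)
    then show "((coord c \<circ> \<gamma>) has_vector_derivative f' t) (at t)"
      using v has_velocity_unique_chart[OF v] by (auto simp: f'_def)
  next
    show "continuous_on {a..b} (coord c \<circ> \<gamma>)"
      unfolding o_def
      by (rule continuous_on_compose2[OF continuous_on_coord[OF c] cont]) (use K in auto)
  qed
  have bound: "norm (m *\<^sub>R f' t) \<le> speed \<gamma> t" if t: "t \<in> {a..b}" and "0 \<le> m" for t
  proof (cases "\<exists>v. has_velocity A \<gamma> v t UNIV")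
    case True
    then obtain v where v: "has_velocity A \<gamma> v t UNIV" by blast
    then have "v \<in> tangent_space A (\<gamma> t)" by (simp add: has_velocity_def)
    then have "speed \<gamma> t = sqrt (chart_form c (coord c (\<gamma> t)) (v c))"
      using speed_eq[OF v] tnorm_chart[OF ch[OF t]] by simp
    moreover have "f' t = v c" using v has_velocity_unique_chart[OF v] by (auto simp: f'_def)
    ultimately show ?thesis using m[OF K(2)[OF t], of "v c"] \<open>0 \<le> m\<close> by simp
  qed (simp add: f'_def speed_nonneg)
  show ?thesis
  proof (cases "0 \<le> m")
    case True
    have "norm (integral {a..b} (\<lambda>t. m *\<^sub>R f' t)) \<le> integral {a..b} (speed \<gamma>)"
      by (rule integral_norm_bound_integral)
         (use f' bound[OF _ True] speed_integrable[OF pw(1)] in \<open>auto intro!: integrable_cmul\<close>)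
    then show ?thesis
      using integral_unique[OF f'] True by (simp add: len_def)
  next
    case False
    then have "m * norm (coord c (\<gamma> b) - coord c (\<gamma> a)) \<le> 0" by (simp add: mult_nonpos_nonneg)
    then show ?thesis using len_nonneg[OF pw(1)] by simp
  qed
qed

text \<open>A curve that leaves a coordinate ball is long, since up to its first exit it crosses the
  ball from the centre to the boundary.\<close>

lemma len_ge_chart_ball:
  assumes pw: "pw_C1 \<gamma> a b" "a \<le> b" and c: "c \<in> A" "\<gamma> a \<in> cdom c"
    and r: "0 < r" "cball (coord c (\<gamma> a)) r \<subseteq> coord c ` cdom c" and "0 < m"
    and m: "\<And>y u. y \<in> cball (coord c (\<gamma> a)) r \<Longrightarrow> m * norm u \<le> sqrt (chart_form c y u)"
  defines "B \<equiv> coord_inv c ` ball (coord c (\<gamma> a)) r"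
  shows "\<gamma> b \<in> B \<Longrightarrow> m * dist (coord c (\<gamma> a)) (coord c (\<gamma> b)) \<le> len \<gamma> a b"
    and "\<gamma> b \<notin> B \<Longrightarrow> m * r \<le> len \<gamma> a b"
proof -
  let ?y = "coord c (\<gamma> a)"
  have Bc: "x \<in> cdom c \<and> coord c x \<in> ball ?y r" if xB: "x \<in> B" for x
  proof -
    obtain z where z: "z \<in> ball ?y r" "x = coord_inv c z" using xB unfolding B_def by blast
    then have "z \<in> coord c ` cdom c" using r(2) by auto
    then show ?thesis using z c(1) by auto
  qed
  have openB: "open B"
    unfolding B_def by (rule open_coord_inv_image[OF c(1)]) (use r in auto)
  have aB: "\<gamma> a \<in> B"
    unfolding B_def by (rule image_eqI[of _ _ ?y]) (use c r in auto)
  have cont: "continuous_on {a..b} \<gamma>" using pw by (simp add: pw_C1_def)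
  have inside: "m * dist ?y (coord c (\<gamma> s)) \<le> len \<gamma> a b"
    if s: "a \<le> s" "s \<le> b" "\<And>t. t \<in> {a..s} \<Longrightarrow> \<gamma> t \<in> B" for s
  proof -
    have "m * norm (coord c (\<gamma> s) - coord c (\<gamma> a)) \<le> len \<gamma> a s"
    proof (rule len_ge_in_chart[OF pw_C1_subinterval[OF pw(1) order_refl s(2)] s(1) c(1)])
      show "\<And>t. t \<in> {a..s} \<Longrightarrow> \<gamma> t \<in> cdom c" "\<And>t. t \<in> {a..s} \<Longrightarrow> coord c (\<gamma> t) \<in> ball ?y r"
        using Bc s(3) by blast+
    qed (use m in auto)
    also have "\<dots> \<le> len \<gamma> a b" by (rule len_le[OF pw(1) s(1,2)])
    finally show ?thesis by (simp add: dist_norm norm_minus_commute)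
  qed
  have exit: "m * r \<le> len \<gamma> a b" if "t \<in> {a..b}" "\<gamma> t \<notin> B" for t
  proof (rule ccontr)
    assume "\<not> m * r \<le> len \<gamma> a b"
    then have lt: "len \<gamma> a b / m < r" using \<open>0 < m\<close> by (simp add: field_simps)
    \<comment> \<open>If the length were below \<open>m * r\<close>, the curve would stay within
      this radius, smaller than \<open>r\<close>, until its first exit at time
      \<open>s\<close>.\<close>
    let ?\<rho> = "len \<gamma> a b / m"
    let ?T = "{t\<in>{a..b}. \<gamma> t \<in> - B}"
    have "closed ?T"
      using continuous_closed_preimage[OF cont closed_atLeastAtMost, of "- B"] openB
      by (simp add: vimage_def Int_def closed_Compl)
    moreover have "?T \<noteq> {}" "bdd_below ?T" using that by (auto intro: bdd_belowI[of _ a])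
    ultimately have "Inf ?T \<in> ?T" by (rule closed_contains_Inf[rotated 2])
    then obtain s where s: "s = Inf ?T" "s \<in> {a..b}" "\<gamma> s \<notin> B" by blast
    have before: "\<gamma> t \<in> B" if "t \<in> {a..<s}" for t
    proof (rule ccontr)
      assume "\<gamma> t \<notin> B"
      then have "t \<in> ?T" using that s(2) by auto
      then have "s \<le> t" unfolding s(1) using \<open>bdd_below ?T\<close> by (rule cInf_lower)
      then show False using that by simp
    qed
    have "a < s" using s(2,3) aB by (cases "a = s") auto
    \<comment> \<open>The exit point may lie outside the chart, so its coordinates cannot be used
      directly. The image of the smaller closed ball is compact, hence closed in the Hausdorff
      manifold, and so contains the limit \<gamma>(s), contrary to its lying outside
      \<open>B\<close>.\<close>
    let ?K = "coord_inv c ` cball ?y ?\<rho>"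
    have K: "cball ?y ?\<rho> \<subseteq> ball ?y r" using lt by auto
    have "cball ?y ?\<rho> \<subseteq> coord c ` cdom c" using K ball_subset_cball r(2) by blast
    then have "compact ?K"
      by (intro compact_continuous_image compact_cball
          continuous_on_subset[OF continuous_on_coord_inv[OF c(1)]])
    then have "closed ?K" by (rule compact_imp_closed)
    then have cl: "closed {t\<in>{a..b}. \<gamma> t \<in> ?K}"
      using continuous_closed_preimage[OF cont closed_atLeastAtMost, of ?K]
      by (simp add: vimage_def Int_def)
    have "{a..<s} \<subseteq> {t\<in>{a..b}. \<gamma> t \<in> ?K}"
    proof
      fix t assume t: "t \<in> {a..<s}"
      have "m * dist ?y (coord c (\<gamma> t)) \<le> len \<gamma> a b"
        by (rule inside) (use t s(2) before in auto)
      then have "coord c (\<gamma> t) \<in> cball ?y ?\<rho>" using \<open>0 < m\<close> by (simp add: field_simps)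
      moreover have "\<gamma> t = coord_inv c (coord c (\<gamma> t))" using Bc[OF before[OF t]] c(1) by simp
      ultimately have "\<gamma> t \<in> ?K" by blast
      then show "t \<in> {t\<in>{a..b}. \<gamma> t \<in> ?K}" using t s(2) by auto
    qed
    then have "closure {a..<s} \<subseteq> {t\<in>{a..b}. \<gamma> t \<in> ?K}" using cl closure_minimal by blast
    moreover have "s \<in> closure {a..<s}" using \<open>a < s\<close> by simp
    ultimately have "\<gamma> s \<in> ?K" by blast
    then show False using s(3) K unfolding B_def by blast
  qed
  show "m * r \<le> len \<gamma> a b" if "\<gamma> b \<notin> B" using exit[of b] that pw(2) by simp
  show "m * dist ?y (coord c (\<gamma> b)) \<le> len \<gamma> a b" if b: "\<gamma> b \<in> B"
  proof (cases "\<forall>t\<in>{a..b}. \<gamma> t \<in> B")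
    case True
    then show ?thesis using inside[of b] pw(2) by auto
  next
    \<comment> \<open>A curve that leaves \<open>B\<close> and returns has already covered at least
      \<open>m * r\<close>, which exceeds the claimed bound.\<close>
    case False
    then have "m * r \<le> len \<gamma> a b" using exit by blast
    moreover have "m * dist ?y (coord c (\<gamma> b)) \<le> m * r"
      using Bc[OF b] \<open>0 < m\<close> by (intro mult_left_mono) auto
    ultimately show ?thesis by linarith
  qed
qed

end

section \<open>The distance as a metric inducing the manifold topology\<close>

locale connected_riemannian = riemannian A g
  for A :: "('m::{t2_space, second_countable_topology}, 'n::finite) chart set" and g +
  assumes connected_UNIV: "connected (UNIV :: 'm set)"
begin

text \<open>Being joined by a curve is an equivalence relation, and every point is joined to all
  points of a coordinate ball around it by segments; connectedness leaves only one class.\<close>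

lemma curve_exists: "\<exists>\<gamma>. pw_C1 \<gamma> 0 1 \<and> \<gamma> 0 = x \<and> \<gamma> 1 = y"
proof (rule connected_equivalence_relation[OF connected_UNIV UNIV_I UNIV_I,
      where R = "\<lambda>x y. \<exists>\<gamma>. pw_C1 \<gamma> 0 1 \<and> \<gamma> 0 = x \<and> \<gamma> 1 = y"])
  fix x y :: 'm
  assume "\<exists>\<gamma>. pw_C1 \<gamma> 0 1 \<and> \<gamma> 0 = x \<and> \<gamma> 1 = y"
  then obtain \<gamma> where \<gamma>: "pw_C1 \<gamma> 0 1" "\<gamma> 0 = x" "\<gamma> 1 = y" by blast
  \<comment> \<open>The reversed curve \<gamma>(1 - s), written as a reflection followed by a shift
    to fit \<open>pw_C1_reverse\<close> and \<open>pw_C1_affine\<close>.\<close>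
  have "pw_C1 (\<lambda>s. \<gamma> (- (1 * s + (- 1)))) 0 1"
    using pw_C1_affine[of "\<lambda>s. \<gamma> (- s)" 1 0 "- 1" 1] pw_C1_reverse[OF \<gamma>(1)] by simp
  then show "\<exists>\<gamma>. pw_C1 \<gamma> 0 1 \<and> \<gamma> 0 = y \<and> \<gamma> 1 = x"
    using \<gamma> by (intro exI[of _ "\<lambda>s. \<gamma> (- (1 * s + (- 1)))"]) simp
next
  fix x y z :: 'm
  assume "\<exists>\<gamma>. pw_C1 \<gamma> 0 1 \<and> \<gamma> 0 = x \<and> \<gamma> 1 = y" "\<exists>\<gamma>. pw_C1 \<gamma> 0 1 \<and> \<gamma> 0 = y \<and> \<gamma> 1 = z"
  then obtain \<gamma> \<delta> where \<gamma>: "pw_C1 \<gamma> 0 1" "\<gamma> 0 = x" "\<gamma> 1 = y"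
    and \<delta>: "pw_C1 \<delta> 0 1" "\<delta> 0 = y" "\<delta> 1 = z" by blast
  let ?\<delta> = "\<lambda>s. \<delta> (1 * s + (- 1))"
  let ?\<eta> = "\<lambda>t. if t \<le> 1 then \<gamma> t else ?\<delta> t"
  have "pw_C1 ?\<delta> 1 2" using \<delta> by (intro pw_C1_affine) auto
  then have "pw_C1 ?\<eta> 0 2" by (intro pw_C1_join) (use \<gamma> \<delta> in auto)
  then have "pw_C1 (\<lambda>s. ?\<eta> (2 * s + 0)) 0 1" by (intro pw_C1_affine) auto
  then show "\<exists>\<gamma>. pw_C1 \<gamma> 0 1 \<and> \<gamma> 0 = x \<and> \<gamma> 1 = z"
    using \<gamma> \<delta> by (intro exI[of _ "\<lambda>s. ?\<eta> (2 * s + 0)"]) simp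
next
  fix x :: 'm
  obtain c r m M where c: "c \<in> A" "x \<in> cdom c" "0 < r"
    "cball (coord c x) r \<subseteq> coord c ` (UNIV \<inter> cdom c)"
    and M: "\<And>y u. y \<in> cball (coord c x) r \<Longrightarrow> sqrt (chart_form c y u) \<le> M * norm u"
    using chart_ball[OF open_UNIV UNIV_I, of x] by metis
  let ?B = "coord_inv c ` ball (coord c x) r"
  have sub: "ball (coord c x) r \<subseteq> coord c ` cdom c" using c by auto
  have "open ?B" by (rule open_coord_inv_image[OF c(1) open_ball sub])
  moreover have "x \<in> ?B" by (rule image_eqI[of _ _ "coord c x"]) (use c in auto)
  moreover have "\<exists>\<gamma>. pw_C1 \<gamma> 0 1 \<and> \<gamma> 0 = x \<and> \<gamma> 1 = z" if "z \<in> ?B" for z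
  proof -
    obtain w where w: "w \<in> ball (coord c x) r" "z = coord_inv c w" using \<open>z \<in> ?B\<close> by blast
    have "pw_C1 (\<lambda>t. coord_inv c (coord c x + t *\<^sub>R (w - coord c x))) 0 1"
      by (rule rdist_segment_le[OF c(1) convex_ball sub _ w(1) M]) (use c in auto)
    then show ?thesis
      using w c by (intro exI[of _ "\<lambda>t. coord_inv c (coord c x + t *\<^sub>R (w - coord c x))"]) simp
  qed
  ultimately have "\<exists>T. open T \<and> x \<in> T \<and> (\<forall>y\<in>T. \<exists>\<gamma>. pw_C1 \<gamma> 0 1 \<and> \<gamma> 0 = x \<and> \<gamma> 1 = y)"
    by blast
  then show "\<exists>T. openin (top_of_set UNIV) T \<and> x \<in> T \<and> (\<forall>y\<in>T. \<exists>\<gamma>. pw_C1 \<gamma> 0 1 \<and> \<gamma> 0 = x \<and> \<gamma> 1 = y)"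
    by simp
qed

text \<open>Connectedness enters here: the set of lengths is nonempty, so its real infimum is a
  genuine one and not an arbitrary value.\<close>

lemma rdist_greatest:
  "(\<And>\<gamma>. pw_C1 \<gamma> 0 1 \<Longrightarrow> \<gamma> 0 = x \<Longrightarrow> \<gamma> 1 = y \<Longrightarrow> k \<le> len \<gamma> 0 1) \<Longrightarrow> k \<le> rdist A g x y"
  unfolding rdist_eq using curve_exists[of x y] by (intro cInf_greatest) blast+

lemma rdist_less_curve:
  assumes "rdist A g x y < k"
  obtains \<gamma> where "pw_C1 \<gamma> 0 1" "\<gamma> 0 = x" "\<gamma> 1 = y" "len \<gamma> 0 1 < k"
  using assms rdist_greatest[of x y k] by (meson not_le)

lemma rdist_nonneg: "0 \<le> rdist A g x y"
  by (rule rdist_greatest) (rule len_nonneg)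

lemma rdist_commute: "rdist A g x y = rdist A g y x"
proof -
  have "rdist A g y x \<le> rdist A g x y" for x y
  proof (rule rdist_greatest)
    fix \<gamma> assume \<gamma>: "pw_C1 \<gamma> 0 1" "\<gamma> 0 = x" "\<gamma> 1 = y"
    from pw_C1_reverse[OF \<gamma>(1)] rdist_le_len[of "- 1" "- 0" "\<lambda>s. \<gamma> (- s)"] len_reverse[OF \<gamma>(1)]
    show "rdist A g y x \<le> len \<gamma> 0 1" using \<gamma> by simp
  qed
  then show ?thesis by (intro antisym)
qed

lemma rdist_triangle: "rdist A g x z \<le> rdist A g x y + rdist A g y z"
proof (rule field_le_epsilon)
  fix e :: real assume "0 < e"
  obtain \<gamma> where \<gamma>: "pw_C1 \<gamma> 0 1" "\<gamma> 0 = x" "\<gamma> 1 = y" "len \<gamma> 0 1 < rdist A g x y + e/2"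
    using rdist_less_curve[of x y "rdist A g x y + e/2"] \<open>0 < e\<close> by auto
  obtain \<delta> where \<delta>: "pw_C1 \<delta> 0 1" "\<delta> 0 = y" "\<delta> 1 = z" "len \<delta> 0 1 < rdist A g y z + e/2"
    using rdist_less_curve[of y z "rdist A g y z + e/2"] \<open>0 < e\<close> by auto
  let ?\<delta> = "\<lambda>s. \<delta> (1 * s + (- 1))"
  let ?\<eta> = "\<lambda>t. if t \<le> 1 then \<gamma> t else ?\<delta> t"
  have pw: "pw_C1 ?\<delta> 1 2" using \<delta> by (intro pw_C1_affine) auto
  have l: "len ?\<delta> 1 2 = len \<delta> 0 1"
    using len_affine[of 1 1 2 \<delta> "- 1"] \<delta> by simp
  have "pw_C1 ?\<eta> 0 2" by (intro pw_C1_join pw) (use \<gamma> \<delta> in auto)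
  from rdist_le_len[OF _ this] have "rdist A g x z \<le> len ?\<eta> 0 2" using \<gamma> \<delta> by simp
  also have "len ?\<eta> 0 2 = len \<gamma> 0 1 + len ?\<delta> 1 2"
    by (rule len_join[OF \<gamma>(1) pw]) (use \<gamma> \<delta> in auto)
  finally show "rdist A g x z \<le> rdist A g x y + rdist A g y z + e"
    using l \<gamma> \<delta> by simp
qed

lemma rdist_ge_chart_ball:
  assumes c: "c \<in> A" "x \<in> cdom c"
    and r: "0 < r" "cball (coord c x) r \<subseteq> coord c ` cdom c" and "0 < m"
    and m: "\<And>y u. y \<in> cball (coord c x) r \<Longrightarrow> m * norm u \<le> sqrt (chart_form c y u)"
  defines "B \<equiv> coord_inv c ` ball (coord c x) r"
  shows "z \<in> B \<Longrightarrow> m * dist (coord c x) (coord c z) \<le> rdist A g x z"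
    and "z \<notin> B \<Longrightarrow> m * r \<le> rdist A g x z"
proof -
  note * = len_ge_chart_ball[OF _ zero_le_one c(1) _ r(1) _ \<open>0 < m\<close>]
  show "m * dist (coord c x) (coord c z) \<le> rdist A g x z" if "z \<in> B"
  proof (rule rdist_greatest)
    fix \<gamma> assume \<gamma>: "pw_C1 \<gamma> 0 1" "\<gamma> 0 = x" "\<gamma> 1 = z"
    show "m * dist (coord c x) (coord c z) \<le> len \<gamma> 0 1"
      by (rule *(1)[of \<gamma>, unfolded \<gamma>(2,3), OF \<gamma>(1) c(2) r(2) m])
        (use that in \<open>simp_all add: B_def\<close>)
  qed
  show "m * r \<le> rdist A g x z" if "z \<notin> B"
  proof (rule rdist_greatest)
    fix \<gamma> assume \<gamma>: "pw_C1 \<gamma> 0 1" "\<gamma> 0 = x" "\<gamma> 1 = z"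
    show "m * r \<le> len \<gamma> 0 1"
      by (rule *(2)[of \<gamma>, unfolded \<gamma>(2,3), OF \<gamma>(1) c(2) r(2) m])
        (use that in \<open>simp_all add: B_def\<close>)
  qed
qed

lemma rdist_self: "rdist A g x x = 0"
proof -
  obtain c r m M where c: "c \<in> A" "x \<in> cdom c" "0 < r"
    "cball (coord c x) r \<subseteq> coord c ` (UNIV \<inter> cdom c)"
    and M: "\<And>y u. y \<in> cball (coord c x) r \<Longrightarrow> sqrt (chart_form c y u) \<le> M * norm u"
    using chart_ball[OF open_UNIV UNIV_I, of x] by metis
  have "rdist A g (coord_inv c (coord c x)) (coord_inv c (coord c x)) \<le> M * norm (coord c x - coord c x)"
    by (rule rdist_segment_le[OF c(1) convex_cball _ _ _ M]) (use c in auto)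
  then show ?thesis using c rdist_nonneg[of x x] by simp
qed

text \<open>The lower constant \<open>m\<close> puts the \<rho>-ball of radius \<open>m * r\<close>
  inside a coordinate ball in \<open>U\<close>; the upper constant \<open>M\<close> puts a
  coordinate ball of radius at most \<open>e / M\<close> inside a \<rho>-ball of radius
  \<open>e\<close>.\<close>

lemma open_iff_rdist: "open U \<longleftrightarrow> (\<forall>x\<in>U. \<exists>e>0. \<forall>y. rdist A g x y < e \<longrightarrow> y \<in> U)"
proof (intro iffI ballI)
  fix x assume U: "open U" "x \<in> U"
  obtain c r m M where c: "c \<in> A" "x \<in> cdom c" "0 < r"
    "cball (coord c x) r \<subseteq> coord c ` (U \<inter> cdom c)" "0 < m"
    and m: "\<And>y u. y \<in> cball (coord c x) r \<Longrightarrow> m * norm u \<le> sqrt (chart_form c y u)"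
    using chart_ball[OF U] by metis
  have "y \<in> U" if "rdist A g x y < m * r" for y
  proof -
    have "y \<in> coord_inv c ` ball (coord c x) r"
      using rdist_ge_chart_ball(2)[OF c(1-3) _ c(5) m] c(4) that by force
    moreover have "coord_inv c w \<in> U" if "w \<in> ball (coord c x) r" for w
    proof -
      have "w \<in> coord c ` (U \<inter> cdom c)" using that c(4) by auto
      then show ?thesis using c(1) by auto
    qed
    ultimately show ?thesis by blast
  qed
  then show "\<exists>e>0. \<forall>y. rdist A g x y < e \<longrightarrow> y \<in> U"
    using c by (intro exI[of _ "m * r"]) simp
next
  assume U: "\<forall>x\<in>U. \<exists>e>0. \<forall>y. rdist A g x y < e \<longrightarrow> y \<in> U"
  show "open U"
  proof (subst open_subopen, intro ballI)
    fix x assume "x \<in> U"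
    then obtain e where e: "e > 0" "\<And>y. rdist A g x y < e \<Longrightarrow> y \<in> U" using U by blast
    obtain c r m M where c: "c \<in> A" "x \<in> cdom c" "0 < r"
      "cball (coord c x) r \<subseteq> coord c ` (UNIV \<inter> cdom c)" "0 < M"
      and M: "\<And>y u. y \<in> cball (coord c x) r \<Longrightarrow> sqrt (chart_form c y u) \<le> M * norm u"
      using chart_ball[OF open_UNIV UNIV_I, of x] by metis
    let ?r = "min r (e / M)"
    let ?B = "coord_inv c ` ball (coord c x) ?r"
    have sub: "cball (coord c x) r \<subseteq> coord c ` cdom c" using c by simp
    have "open ?B" by (rule open_coord_inv_image[OF c(1) open_ball]) (use sub in auto)
    moreover have "x \<in> ?B" by (rule image_eqI[of _ _ "coord c x"]) (use c e in auto)
    moreover have "?B \<subseteq> U"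
    proof
      fix z assume "z \<in> ?B"
      then obtain w where w: "w \<in> ball (coord c x) ?r" "z = coord_inv c w" by blast
      have "rdist A g (coord_inv c (coord c x)) (coord_inv c w) \<le> M * norm (w - coord c x)"
        by (rule rdist_segment_le[OF c(1) convex_cball sub _ _ M]) (use c w in auto)
      also have "\<dots> < M * (e / M)"
        using w c(5) by (intro mult_strict_left_mono) (auto simp: dist_norm norm_minus_commute)
      finally show "z \<in> U" using c w e(2) by simp
    qed
    ultimately show "\<exists>T. open T \<and> x \<in> T \<and> T \<subseteq> U" by blast
  qed
qed

text \<open>Definiteness comes from the topology: the complement of \<open>{y}\<close> is open and
  so contains a \<rho>-ball around any other point.\<close>

lemma rdist_eq_0: "rdist A g x y = 0 \<longleftrightarrow> x = y"
proof
  assume "rdist A g x y = 0"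
  show "x = y"
  proof (rule ccontr)
    assume "x \<noteq> y"
    then have "open (- {y})" "x \<in> - {y}" by auto
    then obtain e where "e > 0" "\<And>z. rdist A g x z < e \<Longrightarrow> z \<in> - {y}"
      unfolding open_iff_rdist by blast
    then show False using \<open>rdist A g x y = 0\<close> by (metis ComplD insertI1)
  qed
qed (simp add: rdist_self)

sublocale rdist: Metric_space UNIV "rdist A g"
  by unfold_locales (auto simp: rdist_nonneg rdist_commute rdist_eq_0 rdist_triangle)

text \<open>The bridge between the two worlds: completeness and total boundedness are stated for the
  explicit metric, compactness for the topology of the type.\<close>

lemma mtopology_eq_euclidean: "rdist.mtopology = euclidean"
  by (simp add: topology_eq rdist.openin_mtopology open_iff_rdist subset_iff Ball_def)

lemma closed_rdist_ball: "closed {y. rdist A g x y \<le> R}"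
  using rdist.closedin_mcball[of x R] by (simp add: mtopology_eq_euclidean rdist.mcball_def)

lemma open_rdist_ball: "open {y. rdist A g x y < R}"
  using rdist.openin_mball[of x R] by (simp add: mtopology_eq_euclidean rdist.mball_def)

section \<open>Compactness of closed balls\<close>

lemma compact_rdist_ball_subset:
  assumes "compact K" "{y. rdist A g x y \<le> R} \<subseteq> K"
  shows "compact {y. rdist A g x y \<le> R}"
proof -
  have "{y. rdist A g x y \<le> R} = K \<inter> {y. rdist A g x y \<le> R}" using assms(2) by blast
  then show ?thesis using compact_Int_closed[OF assms(1) closed_rdist_ball, of x R] by argo
qed

lemma locally_compact_rdist: "\<exists>e>0. compact {y. rdist A g x y \<le> e}"
proof -
  obtain c r m M where c: "c \<in> A" "x \<in> cdom c" "0 < r"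
    "cball (coord c x) r \<subseteq> coord c ` (UNIV \<inter> cdom c)" "0 < m"
    and m: "\<And>y u. y \<in> cball (coord c x) r \<Longrightarrow> m * norm u \<le> sqrt (chart_form c y u)"
    using chart_ball[OF open_UNIV UNIV_I, of x] by metis
  have sub: "cball (coord c x) r \<subseteq> coord c ` cdom c" using c by simp
  let ?K = "coord_inv c ` cball (coord c x) r"
  have "compact ?K"
    by (rule compact_continuous_image[OF continuous_on_subset[OF continuous_on_coord_inv[OF c(1)] sub]]) simp
  \<comment> \<open>Halving makes the distance strictly less than \<open>m * r\<close>, the least
    distance of points outside the coordinate ball.\<close>
  moreover have "{y. rdist A g x y \<le> m * r / 2} \<subseteq> ?K"
  proof
    fix y assume "y \<in> {y. rdist A g x y \<le> m * r / 2}"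
    moreover have "0 < m * r" using c by simp
    ultimately have "rdist A g x y < m * r" by simp
    then have "y \<in> coord_inv c ` ball (coord c x) r"
      using rdist_ge_chart_ball(2)[OF c(1-3) sub c(5) m] by force
    then show "y \<in> ?K" by auto
  qed
  ultimately have "compact {y. rdist A g x y \<le> m * r / 2}"
    by (intro compact_rdist_ball_subset)
  then show ?thesis using c by (intro exI[of _ "m * r / 2"]) simp
qed

text \<open>The length-space property: a nearly shortest curve is cut where its length reaches
  \<open>R\<close>, at a time given by the intermediate value theorem. If the whole curve is no
  longer than \<open>R\<close>, its end point serves.\<close>

lemma rdist_intermediate:
  assumes "rdist A g p z < R + \<delta>" "0 \<le> R" "0 < \<delta>"
  obtains w where "rdist A g p w \<le> R" "rdist A g w z < \<delta>"
proof -
  obtain \<gamma> where \<gamma>: "pw_C1 \<gamma> 0 1" "\<gamma> 0 = p" "\<gamma> 1 = z" "len \<gamma> 0 1 < R + \<delta>"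
    using rdist_less_curve[OF assms(1)] by blast
  show ?thesis
  proof (cases "len \<gamma> 0 1 \<le> R")
    case True
    then show ?thesis
      using that[of z] rdist_le_len[OF _ \<gamma>(1)] \<gamma> assms by (simp add: rdist_self)
  next
    case False
    have "continuous_on {0..1} (\<lambda>t. len \<gamma> 0 t)"
      unfolding len_def by (rule indefinite_integral_continuous_1[OF speed_integrable[OF \<gamma>(1)]])
    moreover have "len \<gamma> 0 0 = 0" by (simp add: len_def)
    ultimately obtain t where t: "0 \<le> t" "t \<le> 1" "len \<gamma> 0 t = R"
      using IVT'[of "\<lambda>t. len \<gamma> 0 t" 0 R 1] assms False by auto
    have "t \<noteq> 1" using t False by auto
    have "rdist A g p (\<gamma> t) \<le> R"
    proof (cases "t = 0")
      case False
      then show ?thesis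
        using rdist_le_len[OF _ pw_C1_subinterval[OF \<gamma>(1) order_refl t(2)]] t \<gamma> by simp
    qed (use \<gamma> assms in \<open>simp add: rdist_self\<close>)
    moreover have "rdist A g (\<gamma> t) z \<le> len \<gamma> t 1"
      using rdist_le_len[OF _ pw_C1_subinterval[OF \<gamma>(1) t(1) order_refl]] t \<gamma> \<open>t \<noteq> 1\<close> by simp
    moreover have "len \<gamma> t 1 < \<delta>" using len_combine[OF \<gamma>(1) t(1,2)] t \<gamma> by simp
    ultimately show ?thesis using that by fastforce
  qed
qed

text \<open>Hopf and Rinow, in the form of Cohn-Vossen: only intermediate points are needed, not
  geodesics. The supremum of the radii of compact balls is attained because the ball is totally
  bounded, and it is not attained because of local compactness.\<close>

theorem compact_closed_ball:
  assumes complete: "rdist.mcomplete"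
  shows "compact {y. rdist A g p y \<le> R}"
proof (rule ccontr)
  let ?C = "\<lambda>R. {y. rdist A g p y \<le> R}"
  assume nc: "\<not> compact (?C R)"
  define S where "S = {R. 0 \<le> R \<and> compact (?C R)}"
  have mono: "compact (?C R')" if "compact (?C R'')" "R' \<le> R''" for R' R''
    by (rule compact_rdist_ball_subset[OF that(1)]) (use that(2) in auto)
  have "?C 0 = {p}" using rdist_nonneg[of p] rdist_eq_0[of p] by (auto simp: order_class.antisym_conv)
  then have "0 \<in> S" by (simp add: S_def)
  have ub: "s \<le> R" if "s \<in> S" for s
  proof (rule ccontr)
    assume "\<not> s \<le> R"
    then show False using mono[of s R] nc that by (simp add: S_def)
  qed
  then have bdd: "bdd_above S" by (rule bdd_aboveI)
  let ?R = "Sup S"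
  have "0 \<le> ?R" using \<open>0 \<in> S\<close> bdd by (rule cSup_upper)
  have "rdist.mtotally_bounded (?C ?R)"
    unfolding rdist.mtotally_bounded_def
  proof (intro allI impI)
    fix e :: real assume "0 < e"
    \<comment> \<open>Thirds suffice: a point of the large ball is within \<open>e/3\<close> of a
      point of the compact ball of radius \<open>s\<close>, and that one within \<open>e/3\<close>
      of the finite net, so the net also serves the large ball at scale \<open>e\<close>.\<close>
    then obtain s where s: "s \<in> S" "?R - e/3 < s"
      using less_cSup_iff[of S "?R - e/3"] \<open>0 \<in> S\<close> bdd by auto
    have "compactin rdist.mtopology (?C s)"
      using s by (simp add: S_def mtopology_eq_euclidean)
    then have "rdist.mtotally_bounded (?C s)" by (rule rdist.compactin_imp_mtotally_bounded)
    then obtain F where F: "finite F" "F \<subseteq> ?C s" "?C s \<subseteq> (\<Union>x\<in>F. rdist.mball x (e/3))"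
      using \<open>0 < e\<close> unfolding rdist.mtotally_bounded_def by (meson divide_pos_pos zero_less_numeral)
    have "?C ?R \<subseteq> (\<Union>x\<in>F. rdist.mball x e)"
    proof
      fix z assume "z \<in> ?C ?R"
      then have "rdist A g p z < s + e/3" using s by simp
      then obtain w where w: "rdist A g p w \<le> s" "rdist A g w z < e/3"
        using rdist_intermediate[of p z s "e/3"] s \<open>0 < e\<close> by (auto simp: S_def)
      then obtain x where x: "x \<in> F" "rdist A g x w < e/3" using F(3) by auto
      have "rdist A g x z < e" using rdist_triangle[of x z w] w x \<open>0 < e\<close> by linarith
      then show "z \<in> (\<Union>x\<in>F. rdist.mball x e)" using x by auto
    qed
    moreover have "s \<le> ?R" using s(1) bdd by (rule cSup_upper)
    ultimately show "\<exists>K. finite K \<and> K \<subseteq> ?C ?R \<and> ?C ?R \<subseteq> (\<Union>x\<in>K. rdist.mball x e)"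
      using F by (intro exI[of _ F]) auto
  qed
  then have "compact (closure (?C ?R))"
    using rdist.mtotally_bounded_eq_compact_closure_of[OF complete]
    by (simp add: mtopology_eq_euclidean)
  then have cR: "compact (?C ?R)" by (simp add: closure_closed[OF closed_rdist_ball])
  obtain e where e: "\<And>x. 0 < e x" "\<And>x. compact {y. rdist A g x y \<le> e x}"
    using locally_compact_rdist by metis
  \<comment> \<open>Covering by half radii leaves a margin of at least \<delta> around each selected
    ball, which absorbs the enlargement of the radius beyond the supremum.\<close>
  let ?B = "\<lambda>x. {y. rdist A g x y < e x / 2}"
  have cover: "?C ?R \<subseteq> \<Union> (?B ` ?C ?R)" using e(1) by (auto simp: rdist_self)
  obtain F where F: "F \<subseteq> ?C ?R" "finite F" "?C ?R \<subseteq> \<Union> (?B ` F)"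
    by (rule compactE_image[OF cR open_rdist_ball cover])
  have "p \<in> ?C ?R" using \<open>0 \<le> ?R\<close> by (simp add: rdist_self)
  then have "F \<noteq> {}" using F(3) by blast
  define \<delta> where "\<delta> = Min ((\<lambda>x. e x / 2) ` F)"
  have "0 < \<delta>" unfolding \<delta>_def using F(2) \<open>F \<noteq> {}\<close> e(1) by simp
  have \<delta>: "\<delta> \<le> e x / 2" if "x \<in> F" for x unfolding \<delta>_def using F(2) that by (intro Min_le) auto
  have "?C (?R + \<delta>/2) \<subseteq> (\<Union>x\<in>F. {y. rdist A g x y \<le> e x})"
  proof
    fix z assume "z \<in> ?C (?R + \<delta>/2)"
    then have "rdist A g p z < ?R + \<delta>" using \<open>0 < \<delta>\<close> by simp
    then obtain w where w: "rdist A g p w \<le> ?R" "rdist A g w z < \<delta>"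
      using rdist_intermediate[OF _ \<open>0 \<le> ?R\<close> \<open>0 < \<delta>\<close>] by blast
    then obtain x where x: "x \<in> F" "rdist A g x w < e x / 2" using F(3) by auto
    have "rdist A g x z \<le> e x" using rdist_triangle[of x z w] w x \<delta>[OF x(1)] by linarith
    then show "z \<in> (\<Union>x\<in>F. {y. rdist A g x y \<le> e x})" using x by auto
  qed
  moreover have "compact (\<Union>x\<in>F. {y. rdist A g x y \<le> e x})" using F(2) e(2) by (intro compact_UN) auto
  ultimately have "compact (?C (?R + \<delta>/2))"
    by (intro compact_rdist_ball_subset)
  then have "?R + \<delta>/2 \<in> S" using \<open>0 \<le> ?R\<close> \<open>0 < \<delta>\<close> by (simp add: S_def)
  then have "?R + \<delta>/2 \<le> ?R" using bdd by (rule cSup_upper)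
  then show False using \<open>0 < \<delta>\<close> by simp
qed

end

section \<open>Solutions on manifolds\<close>

text \<open>For gluing solutions: at the junction time the left and right derivatives agree and give
  the derivative on the union.\<close>

lemma has_vector_derivative_within_Un:
  fixes f :: "real \<Rightarrow> 'a::real_normed_vector"
  assumes "(f has_vector_derivative v) (at t within S)" "(f has_vector_derivative v) (at t within T)"
  shows "(f has_vector_derivative v) (at t within S \<union> T)"
  using assms unfolding has_vector_derivative_def has_derivative_within by (simp add: Lim_within_Un)

context atlas begin

text \<open>The compact-interval analogue of \<open>solution_from\<close>. Derivatives are one-sided
  at both ends, so that pieces can be restricted and glued.\<close>

definition solution_on :: "'m set \<Rightarrow> (real \<Rightarrow> 'm \<Rightarrow> ('m, 'n) tvec) \<Rightarrow> real \<Rightarrow> real \<Rightarrow> (real \<Rightarrow> 'm) \<Rightarrow> bool" where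
  "solution_on D f s u x \<longleftrightarrow> continuous_on {s..u} x \<and>
     (\<forall>t\<in>{s..u}. x t \<in> D \<and> has_velocity A x (f t (x t)) t {s..u})"

lemma solution_on_subset:
  assumes "solution_on D f s u x" "s \<le> s'" "u' \<le> u"
  shows "solution_on D f s' u' x"
  unfolding solution_on_def
proof (intro conjI ballI)
  have sub: "{s'..u'} \<subseteq> {s..u}" using assms by auto
  show "continuous_on {s'..u'} x"
    using assms(1) sub continuous_on_subset unfolding solution_on_def by blast
  fix t assume "t \<in> {s'..u'}"
  then show "x t \<in> D" "has_velocity A x (f t (x t)) t {s'..u'}"
    using assms(1) sub has_velocity_subset unfolding solution_on_def by blast+
qed

lemma solution_from_imp_solution_on:
  assumes "solution_from A D f s x"
  shows "solution_on D f s u x"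
  unfolding solution_on_def
proof (intro conjI ballI)
  show "continuous_on {s..u} x"
    using assms continuous_on_subset[of "{s..}" x "{s..u}"] unfolding solution_from_def by auto
  fix t assume "t \<in> {s..u}"
  then show "x t \<in> D" "has_velocity A x (f t (x t)) t {s..u}"
    using assms has_velocity_subset[of x _ t "{s..}" "{s..u}"] unfolding solution_from_def by auto
qed

lemma has_velocity_within_nhd:
  assumes "has_velocity A \<gamma> v t I" "t \<in> U" "open U" "I \<inter> U - {t} = J \<inter> U - {t}"
  shows "has_velocity A \<gamma> v t J"
proof -
  have "at t within I = at t within J" by (rule at_within_nhd[OF assms(2-4)])
  with assms(1) show ?thesis by (simp add: has_velocity_def)
qed

lemma solution_on_join:
  assumes 1: "solution_on D f s u x" and 2: "solution_on D f u w y" and "x u = y u" "s \<le> u" "u \<le> w"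
  shows "solution_on D f s w (\<lambda>t. if t \<le> u then x t else y t)" (is "solution_on D f s w ?z")
  unfolding solution_on_def
proof (intro conjI ballI)
  have sw: "{s..w} = {s..u} \<union> {u..w}" using assms by auto
  have zx: "?z t = x t" if "t \<in> {s..u}" for t using that by simp
  have zy: "?z t = y t" if "t \<in> {u..w}" for t using that assms(3) by (cases "t = u") auto
  have "continuous_on {s..u} ?z"
    by (rule continuous_on_eq[of _ x]) (use 1 zx in \<open>auto simp: solution_on_def\<close>)
  moreover have "continuous_on {u..w} ?z"
    by (rule continuous_on_eq[of _ y]) (use 2 zy in \<open>auto simp: solution_on_def\<close>)
  ultimately show "continuous_on {s..w} ?z"
    unfolding sw by (intro continuous_on_closed_Un) auto
  fix t assume t: "t \<in> {s..w}"
  have L: "has_velocity A ?z (f t (?z t)) t {s..u}" if t: "t \<in> {s..u}"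
  proof -
    have "has_velocity A x (f t (x t)) t {s..u}" using 1 t by (simp add: solution_on_def)
    from has_velocity_cong[OF this t zx] show ?thesis by (simp only: zx[OF t])
  qed
  have R: "has_velocity A ?z (f t (?z t)) t {u..w}" if t: "t \<in> {u..w}"
  proof -
    have "has_velocity A y (f t (y t)) t {u..w}" using 2 t by (simp add: solution_on_def)
    from has_velocity_cong[OF this t zy] show ?thesis by (simp only: zy[OF t])
  qed
  show "?z t \<in> D" using 1 2 t by (auto simp: solution_on_def)
  consider "t < u" | "t = u" | "t > u" by linarith
  then show "has_velocity A ?z (f t (?z t)) t {s..w}"
  proof cases
    case 1
    then show ?thesis
      by (intro has_velocity_within_nhd[OF L, of "{..<u}"]) (use t assms in auto)
  next
    \<comment> \<open>Both one-sided velocities at the junction equal the vector field at the common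
      point, so no corner arises.\<close>
    case 2
    then have tt: "t \<in> {s..u}" "t \<in> {u..w}" using assms by auto
    show ?thesis
      using L[OF tt(1)] R[OF tt(2)] unfolding has_velocity_def sw
      by (blast intro: has_vector_derivative_within_Un)
  next
    case 3
    then show ?thesis
      by (intro has_velocity_within_nhd[OF R, of "{u<..}"]) (use t assms in auto)
  qed
qed

text \<open>The differential equation is solved in one chart and carried back. The point of this
  form is uniformity: one \<delta> serves all initial times up to \<open>T\<close> and all starting
  points near \<open>p\<close>.\<close>

lemma local_existence:
  assumes tv: "time_vector_field A D f" and ct: "continuous_in_time A D f"
    and lip: "locally_lipschitz_in_space A D f" and p: "p \<in> D" and "0 \<le> T"
  obtains N \<delta> where "open N" "p \<in> N" "0 < \<delta>"
    "\<And>s q. s \<in> {0..T} \<Longrightarrow> q \<in> N \<Longrightarrow> \<exists>x. x s = q \<and> solution_on D f s (s + \<delta>) x"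
proof -
  obtain c where c: "c \<in> A" "p \<in> cdom c" using chart_exists by blast
  \<comment> \<open>The horizon is \<open>T + 1\<close> because a solution starting by time
    \<open>T\<close> runs on for a further \<delta> \<le> 1.\<close>
  have "p \<in> D \<inter> cdom c" "0 \<le> T + 1" using p c \<open>0 \<le> T\<close> by auto
  then obtain U L where U: "open U" "p \<in> U" "U \<subseteq> D \<inter> cdom c"
    and L: "\<forall>t\<in>{0..T+1}. L-lipschitz_on (coord c ` U) (\<lambda>y. f t (coord_inv c y) c)"
    using lip c(1) unfolding locally_lipschitz_in_space_def by meson
  let ?y = "coord c p"
  have "open (coord c ` U)" by (rule open_coord_image) (use c U in auto)
  then obtain e where e: "0 < e" "cball ?y e \<subseteq> coord c ` U"
    using U(2) open_contains_cball by (metis imageI)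
  define b where "b = e / 2"
  have b: "0 < b" "cball ?y (2 * b) \<subseteq> coord c ` U" using e by (auto simp: b_def)
  define F where "F = (\<lambda>t y. f t (coord_inv c y) c)"
  have inU: "coord_inv c z \<in> U" "coord c (coord_inv c z) = z" if z: "z \<in> cball ?y (2 * b)" for z
  proof -
    obtain x where "x \<in> U" "z = coord c x" using b(2) z by blast
    moreover have "x \<in> cdom c" using U(3) \<open>x \<in> U\<close> by blast
    ultimately show "coord_inv c z \<in> U" "coord c (coord_inv c z) = z" using c(1) by auto
  qed
  have sub: "cball ?y (2 * b) \<subseteq> coord c ` cdom c" using b(2) U(3) by blast
  obtain \<delta> where \<delta>: "0 < \<delta>" "\<delta> \<le> 1"
    "\<And>s q. 0 \<le> s \<Longrightarrow> s + \<delta> \<le> T + 1 \<Longrightarrow> q \<in> cball ?y b \<Longrightarrow>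
      \<exists>y. y s = q \<and> (\<forall>t\<in>{s..s+\<delta>}. y t \<in> cball ?y (2*b) \<and>
            (y has_vector_derivative F t (y t)) (at t within {s..s+\<delta>}))"
  proof (rule picard_lindelof_uniform[OF b(1), of "T + 1" L ?y F])
    show "L-lipschitz_on (cball ?y (2 * b)) (F t)" if "t \<in> {0..T+1}" for t
      using lipschitz_on_subset[OF L[rule_format, OF that] b(2)] by (simp add: F_def)
    show "continuous_on {0..T+1} (\<lambda>t. F t z)" if z: "z \<in> cball ?y (2 * b)" for z
    proof -
      have "coord_inv c z \<in> D" "c \<in> charts_at A (coord_inv c z)"
        using inU[OF z] U(3) c(1) by (auto simp: charts_at_iff)
      then have "continuous_on {0..} (\<lambda>t. F t z)"
        using ct unfolding continuous_in_time_def F_def by blast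
      then show ?thesis by (rule continuous_on_subset) auto
    qed
  qed (use \<open>0 \<le> T\<close> in auto)
  let ?N = "coord_inv c ` ball ?y b"
  have bsub: "ball ?y b \<subseteq> cball ?y (2 * b)" using b(1) by auto
  show ?thesis
  proof (rule that[of ?N \<delta>])
    show "open ?N" using open_coord_inv_image[OF c(1) open_ball] bsub sub by blast
    show "p \<in> ?N" by (rule image_eqI[of _ _ ?y]) (use c b in auto)
    show "0 < \<delta>" by fact
    fix s q assume s: "s \<in> {0..T}" and "q \<in> ?N"
    then obtain z where z: "z \<in> ball ?y b" "q = coord_inv c z" by blast
    let ?I = "{s..s+\<delta>}"
    obtain y where y: "y s = z" "\<And>t. t \<in> ?I \<Longrightarrow> y t \<in> cball ?y (2*b)"
      "\<And>t. t \<in> ?I \<Longrightarrow> (y has_vector_derivative F t (y t)) (at t within ?I)"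
      using \<delta>(3)[of s z] s \<delta>(2) z(1) by auto
    let ?x = "\<lambda>t. coord_inv c (y t)"
    have cy: "continuous_on ?I y"
      using y(3) has_vector_derivative_continuous unfolding continuous_on_eq_continuous_within by blast
    have cx: "continuous_on ?I ?x"
      by (rule continuous_on_compose2[OF continuous_on_coord_inv[OF c(1)] cy]) (use y(2) sub in blast)
    have x: "?x t \<in> D" "c \<in> charts_at A (?x t)" if "t \<in> ?I" for t
      using inU[OF y(2)[OF that]] U(3) c(1) by (auto simp: charts_at_iff)
    have "has_velocity A ?x (f t (?x t)) t ?I" if t: "t \<in> ?I" for t
    proof (subst has_velocity_iff_chart[OF x(2)[OF t] t cx])
      show "f t (?x t) \<in> tangent_space A (?x t)"
        using tv x(1)[OF t] t s unfolding time_vector_field_def by auto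
      show "((coord c \<circ> ?x) has_vector_derivative f t (?x t) c) (at t within ?I)"
        by (rule has_vector_derivative_transform[OF t _ y(3)[OF t, unfolded F_def]])
           (use inU(2)[OF y(2)] in simp)
    qed
    then have "solution_on D f s (s + \<delta>) ?x"
      using cx x(1) by (simp add: solution_on_def)
    then show "\<exists>x. x s = q \<and> solution_on D f s (s + \<delta>) x" using y(1) z(2) by (intro exI[of _ ?x]) simp
  qed
qed

text \<open>Finitely many neighbourhoods from \<open>local_existence\<close> cover \<open>K\<close>;
  the least of their existence times works. The empty set is treated apart since that minimum would
  be undefined.\<close>

lemma uniform_existence:
  assumes f: "time_vector_field A D f" "continuous_in_time A D f" "locally_lipschitz_in_space A D f"
    and K: "compact K" "K \<subseteq> D" and "0 \<le> T"
  obtains \<delta> where "0 < \<delta>"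
    "\<And>s q. s \<in> {0..T} \<Longrightarrow> q \<in> K \<Longrightarrow> \<exists>x. x s = q \<and> solution_on D f s (s + \<delta>) x"
proof (cases "K = {}")
  case True
  then show ?thesis using that[of 1] by simp
next
  case False
  have "\<exists>N \<delta>. open N \<and> p \<in> N \<and> 0 < \<delta> \<and>
    (\<forall>s\<in>{0..T}. \<forall>q\<in>N. \<exists>x. x s = q \<and> solution_on D f s (s + \<delta>) x)" if "p \<in> K" for p
    using local_existence[OF f _ \<open>0 \<le> T\<close>, of p] that K(2) by (metis subsetD)
  then obtain N d where Nd: "\<And>p. p \<in> K \<Longrightarrow> open (N p)" "\<And>p. p \<in> K \<Longrightarrow> p \<in> N p"
    "\<And>p. p \<in> K \<Longrightarrow> 0 < d p"
    "\<And>p s q. p \<in> K \<Longrightarrow> s \<in> {0..T} \<Longrightarrow> q \<in> N p \<Longrightarrow> \<exists>x. x s = q \<and> solution_on D f s (s + d p) x"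
    by metis
  have cover: "K \<subseteq> (\<Union>p\<in>K. N p)" using Nd(2) by blast
  obtain P where P: "P \<subseteq> K" "finite P" "K \<subseteq> (\<Union>p\<in>P. N p)"
    by (rule compactE_image[OF K(1) Nd(1) cover])
  have "P \<noteq> {}" using P(3) False by blast
  show ?thesis
  proof (rule that[of "Min (d ` P)"])
    show "0 < Min (d ` P)" using P(1,2) \<open>P \<noteq> {}\<close> Nd(3) by (auto simp: subset_iff)
    fix s q assume sq: "s \<in> {0..T}" "q \<in> K"
    then obtain p where p: "p \<in> P" "q \<in> N p" using P(3) by blast
    then obtain x where x: "x s = q" "solution_on D f s (s + d p) x" using Nd(4) P(1) sq(1) by blast
    have "Min (d ` P) \<le> d p" using P(2) p(1) by simp
    then have "solution_on D f s (s + Min (d ` P)) x"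
      by (intro solution_on_subset[OF x(2)]) auto
    then show "\<exists>x. x s = q \<and> solution_on D f s (s + Min (d ` P)) x" using x(1) by blast
  qed
qed

text \<open>\<open>Q\<close> is positively invariant. Since it stays in a compact set, the local existence time is
  uniform, and finitely many local solutions cover a unit interval.\<close>

lemma unit_existence:
  assumes f: "time_vector_field A D f" "continuous_in_time A D f" "locally_lipschitz_in_space A D f"
    and K: "compact K" "K \<subseteq> D" and QK: "\<And>s. 0 \<le> s \<Longrightarrow> Q s \<subseteq> K"
    and inv: "\<And>s u x. 0 \<le> s \<Longrightarrow> s \<le> u \<Longrightarrow> solution_on D f s u x \<Longrightarrow> x s \<in> Q s \<Longrightarrow> x u \<in> Q u"
    and s: "0 \<le> s" and q: "q \<in> Q s"
  shows "\<exists>x. x s = q \<and> solution_on D f s (s + 1) x"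
proof -
  obtain \<delta> where \<delta>: "0 < \<delta>"
    "\<And>s' q. s' \<in> {0..s+1} \<Longrightarrow> q \<in> K \<Longrightarrow> \<exists>x. x s' = q \<and> solution_on D f s' (s' + \<delta>) x"
    using uniform_existence[OF f K, of "s + 1"] s by auto
  have step: "\<exists>x. x s = q \<and> solution_on D f s (s + real (Suc n) * \<delta>) x" if "real n * \<delta> \<le> 1" for n
    using that
  proof (induction n)
    case 0
    show ?case using \<delta>(2)[of s q] QK[OF s] q s by auto
  next
    case (Suc n)
    have "real n * \<delta> \<le> real (Suc n) * \<delta>" using \<delta>(1) by (intro mult_right_mono) auto
    then obtain x where x: "x s = q" "solution_on D f s (s + real (Suc n) * \<delta>) x"
      using Suc by force
    let ?u = "s + real (Suc n) * \<delta>"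
    have su: "s \<le> ?u" using \<delta>(1) by simp
    have "x ?u \<in> Q ?u" by (rule inv[OF s su x(2)]) (use x(1) q in simp)
    then have "x ?u \<in> K" using QK[of ?u] s su by auto
    then obtain y where y: "y ?u = x ?u" "solution_on D f ?u (?u + \<delta>) y"
      using \<delta>(2)[of ?u "x ?u"] Suc.prems s su by auto
    have "solution_on D f s (?u + \<delta>) (\<lambda>t. if t \<le> ?u then x t else y t)"
      using solution_on_join[OF x(2) y(2) y(1)[symmetric] su] \<delta>(1) by simp
    moreover have u: "s + real (Suc (Suc n)) * \<delta> = ?u + \<delta>" by (simp add: algebra_simps)
    ultimately show ?case
      unfolding u using x(1) su by (intro exI[of _ "\<lambda>t. if t \<le> ?u then x t else y t"]) simp
  qed
  \<comment> \<open>The last \<open>n\<close> with \<open>n * \<delta> \<le> 1\<close>: every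
    restart happens by time \<open>s + 1\<close>, where \<delta> is valid, and \<open>n + 1\<close>
    steps cover the unit interval.\<close>
  define n where "n = nat \<lfloor>1 / \<delta>\<rfloor>"
  have "real n = real_of_int \<lfloor>1 / \<delta>\<rfloor>" using \<delta>(1) by (simp add: n_def)
  then have n: "real n \<le> 1 / \<delta>" "1 / \<delta> \<le> real (Suc n)" by linarith+
  then have "real n * \<delta> \<le> 1" "1 \<le> real (Suc n) * \<delta>"
    using \<delta>(1) by (simp_all add: field_simps)
  with step[of n] solution_on_subset[of D f s "s + real (Suc n) * \<delta>" _ s "s + 1"]
  show ?thesis by auto
qed

text \<open>The uniform existence time depends on the time horizon and may shrink as the horizon
  grows. Solutions are therefore prolonged by unit intervals, each of which is reached with its own
  \<delta>.\<close>

lemma global_existence: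
  assumes f: "time_vector_field A D f" "continuous_in_time A D f" "locally_lipschitz_in_space A D f"
    and K: "compact K" "K \<subseteq> D" and QK: "\<And>s. 0 \<le> s \<Longrightarrow> Q s \<subseteq> K"
    and inv: "\<And>s u x. 0 \<le> s \<Longrightarrow> s \<le> u \<Longrightarrow> solution_on D f s u x \<Longrightarrow> x s \<in> Q s \<Longrightarrow> x u \<in> Q u"
    and s: "0 \<le> s" and q: "q \<in> Q s"
  shows "\<exists>x. x s = q \<and> solution_from A D f s x"
proof -
  have unit: "\<exists>x. x s = q \<and> solution_on D f s (s + 1) x" if "0 \<le> s" "q \<in> Q s" for s q
    by (rule unit_existence[where Q = Q, OF f K _ _ that]) (fact QK, fact inv)
  \<comment> \<open>Dependent choice yields a chain in which every solution extends the preceding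
    one, so their common extension is well defined.\<close>
  have "\<exists>Y. \<forall>n. (solution_on D f s (s + real (Suc n)) (Y n) \<and> Y n s = q) \<and>
      (\<forall>t\<in>{s..s + real (Suc n)}. Y (Suc n) t = Y n t)"
  proof (rule dependent_nat_choice)
    show "\<exists>x. solution_on D f s (s + real (Suc 0)) x \<and> x s = q"
      using unit[OF s q] by auto
    fix x n assume x: "solution_on D f s (s + real (Suc n)) x \<and> x s = q"
    let ?u = "s + real (Suc n)"
    have "x ?u \<in> Q ?u" by (rule inv[OF s]) (use x q in auto)
    then obtain y where y: "y ?u = x ?u" "solution_on D f ?u (?u + 1) y"
      using unit[of ?u "x ?u"] s by auto
    let ?z = "\<lambda>t. if t \<le> ?u then x t else y t"
    have "solution_on D f s (?u + 1) ?z"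
      by (rule solution_on_join[where x = x and y = y, OF _ y(2) y(1)[symmetric]]) (use x in auto)
    moreover have u: "s + real (Suc (Suc n)) = ?u + 1" by simp
    ultimately show "\<exists>z. (solution_on D f s (s + real (Suc (Suc n))) z \<and> z s = q) \<and>
        (\<forall>t\<in>{s..?u}. z t = x t)"
      unfolding u using x by (intro exI[of _ ?z]) simp
  qed
  then obtain Y where Y: "\<And>n. solution_on D f s (s + real (Suc n)) (Y n)" "\<And>n. Y n s = q"
    "\<And>n t. t \<in> {s..s + real (Suc n)} \<Longrightarrow> Y (Suc n) t = Y n t"
    by blast
  have agree: "Y (n + k) t = Y n t" if "t \<in> {s..s + real (Suc n)}" for n k t
    using that by (induction k) (simp_all add: Y(3))
  \<comment> \<open>Any member of the chain whose interval contains \<open>t\<close> gives the same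
    value; rounding \<open>t - s\<close> up selects one.\<close>
  define x where "x = (\<lambda>t. Y (nat \<lceil>t - s\<rceil>) t)"
  have x: "x t = Y n t" if t: "t \<in> {s..s + real (Suc n)}" for n t
  proof -
    define m where "m = nat \<lceil>t - s\<rceil>"
    have "t - s \<le> real m" unfolding m_def by (rule real_nat_ceiling_ge)
    then have "t \<in> {s..s + real (Suc m)}" using t by simp
    then have "Y m t = Y n t"
      using agree[of t m "n - m"] agree[of t n "m - n"] t by (cases "m \<le> n") auto
    then show ?thesis by (simp add: x_def m_def)
  qed
  have nhd: "\<exists>n. t < s + real (Suc n)" for t
  proof -
    obtain n where "t - s < real n" using reals_Archimedean2 by blast
    then show ?thesis by (intro exI[of _ n]) simp
  qed
  have vel: "x t \<in> D \<and> has_velocity A x (f t (x t)) t {s..}" if t: "s \<le> t" for t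
  proof -
    obtain n where n: "t < s + real (Suc n)" using nhd by blast
    let ?I = "{s..s + real (Suc n)}"
    have tI: "t \<in> ?I" using t n by simp
    have "Y n t \<in> D" "has_velocity A (Y n) (f t (Y n t)) t ?I"
      using Y(1)[of n] tI by (auto simp: solution_on_def)
    then have "x t \<in> D" "has_velocity A x (f t (x t)) t ?I"
      using has_velocity_cong[of "Y n" "f t (Y n t)" t ?I x] tI x by auto
    moreover have "has_velocity A x (f t (x t)) t {s..}"
      by (rule has_velocity_within_nhd[of _ _ _ ?I "{..<s + real (Suc n)}"]) (use calculation n in auto)
    ultimately show ?thesis by blast
  qed
  have "continuous_on {s..} x"
    unfolding continuous_on_eq_continuous_within
  proof
    fix t assume t: "t \<in> {s..}"
    obtain n where n: "t < s + real (Suc n)" using nhd by blast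
    let ?I = "{s..s + real (Suc n)}"
    have "continuous_on ?I x"
      using Y(1)[of n] x continuous_on_cong[of ?I ?I x "Y n"] by (auto simp: solution_on_def)
    then have "continuous (at t within ?I) x"
      using t n by (simp add: continuous_on_eq_continuous_within)
    moreover have "at t within {s..} = at t within ?I"
      by (rule at_within_nhd[of t "{..<s + real (Suc n)}"]) (use n in auto)
    ultimately show "continuous (at t within {s..}) x" by simp
  qed
  moreover have "x s = q" using x[of s 0] Y(2)[of 0] by simp
  ultimately show ?thesis using vel by (intro exI[of _ x]) (auto simp: solution_from_def)
qed

end

section \<open>The Lyapunov function\<close>

context atlas begin

text \<open>One total derivative \<open>F\<close> is evaluated along three curves or slices: the
  time line gives \<open>time_deriv\<close>, the spatial slice gives \<open>differential\<close>,
  and the graph of the solution gives the derivative sought. Linearity of \<open>F\<close> adds the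
  first two.\<close>

lemma lyapunov_chain_rule:
  assumes V: "C1_time_function A D V" and D: "open D" and x: "solution_on D f s u x"
    and s: "0 \<le> s" and t: "t \<in> {s..u}"
  shows "((\<lambda>r. V r (x r)) has_real_derivative
      time_deriv V t (x t) + differential A (V t) (x t) (f t (x t))) (at t within {s..u})"
proof -
  \<comment> \<open>The very chart selected in \<open>differential\<close>, so the two expressions
    can be matched directly.\<close>
  define c where "c = (SOME c. c \<in> charts_at A (x t))"
  have "\<exists>c. c \<in> charts_at A (x t)" using chart_exists charts_at_iff by blast
  then have cx: "c \<in> charts_at A (x t)" unfolding c_def by (rule someI_ex)
  then have c: "c \<in> A" "x t \<in> cdom c" by (auto simp: charts_at_iff)
  have xD: "x r \<in> D" if "r \<in> {s..u}" for r using x that by (simp add: solution_on_def)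
  have cont: "continuous_on {s..u} x" using x by (simp add: solution_on_def)
  let ?W = "coord c ` (D \<inter> cdom c)"
  let ?S = "{0..} \<times> ?W"
  let ?H = "\<lambda>(t, y). V t (coord_inv c y)"
  let ?y = "coord c (x t)"
  let ?w = "f t (x t) c"
  have W: "open ?W" by (intro open_coord_image open_Int open_cdom c D) simp
  have yW: "?y \<in> ?W" using xD[OF t] c by blast
  have t0: "0 \<le> t" using s t by simp
  then have pS: "(t, ?y) \<in> ?S" using yW by simp
  obtain F :: "real \<times> (real^'n) \<Rightarrow> (real \<times> (real^'n)) \<Rightarrow>\<^sub>L real" where
    F: "\<And>p. p \<in> ?S \<Longrightarrow> (?H has_derivative blinfun_apply (F p)) (at p within ?S)"
    using V c(1) unfolding C1_time_function_def Let_def by blast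
  let ?F = "blinfun_apply (F (t, ?y))"
  have H: "(?H has_derivative ?F) (at (t, ?y) within ?S)" by (rule F[OF pS])
  have lin: "linear ?F" using blinfun.bounded_linear_right bounded_linear.linear by blast

  have "((\<lambda>r. (r, ?y)) has_derivative (\<lambda>h. (h, 0))) (at t within {0..})"
    by (auto intro!: derivative_eq_intros)
  moreover have "(?H has_derivative ?F) (at (t, ?y) within (\<lambda>r. (r, ?y)) ` {0..})"
    by (rule has_derivative_subset[OF H]) (use yW in auto)
  ultimately have "((?H \<circ> (\<lambda>r. (r, ?y))) has_derivative (?F \<circ> (\<lambda>h. (h, 0)))) (at t within {0..})"
    by (intro diff_chain_within) auto
  moreover have "?F \<circ> (\<lambda>h. (h, 0)) = (\<lambda>h. h *\<^sub>R ?F (1, 0))"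
  proof
    fix h :: real
    have "?F (h, 0) = ?F (h *\<^sub>R (1, 0))" by simp
    also have "\<dots> = h *\<^sub>R ?F (1, 0)" by (rule linear_scale[OF lin])
    finally show "(?F \<circ> (\<lambda>h. (h, 0))) h = h *\<^sub>R ?F (1, 0)" by simp
  qed
  moreover have "?H \<circ> (\<lambda>r. (r, ?y)) = (\<lambda>r. V r (x t))" using c by (simp add: fun_eq_iff)
  ultimately have "((\<lambda>r. V r (x t)) has_vector_derivative ?F (1, 0)) (at t within {0..})"
    by (simp add: has_vector_derivative_def)
  \<comment> \<open>Uniqueness of the one-sided derivative needs a nontrivial filter, also at time
    0.\<close>
  moreover have "at t within {0..} \<noteq> bot"
  proof -
    have "{t<..} \<subseteq> {0..} - {t}" using t0 by auto
    then have "closure {t<..} \<subseteq> closure ({0..} - {t})" by (rule closure_mono)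
    then show ?thesis by (auto simp: at_within_eq_bot_iff)
  qed
  ultimately have td: "time_deriv V t (x t) = ?F (1, 0)"
    unfolding time_deriv_def by (intro vector_derivative_within)

  have "((\<lambda>z. (t, z)) has_derivative (\<lambda>h. (0, h))) (at ?y within ?W)"
    by (auto intro!: derivative_eq_intros)
  moreover have "(?H has_derivative ?F) (at (t, ?y) within (\<lambda>z. (t, z)) ` ?W)"
    by (rule has_derivative_subset[OF H]) (use t0 in auto)
  ultimately have "((?H \<circ> (\<lambda>z. (t, z))) has_derivative (?F \<circ> (\<lambda>h. (0, h)))) (at ?y within ?W)"
    by (intro diff_chain_within) auto
  then have "((V t \<circ> coord_inv c) has_derivative (\<lambda>h. ?F (0, h))) (at ?y)"
    using at_within_open[OF yW W] by (simp add: o_def)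
  from frechet_derivative_at[OF this]
  have df: "differential A (V t) (x t) (f t (x t)) = ?F (0, ?w)"
    unfolding differential_def Let_def c_def[symmetric] by metis

  \<comment> \<open>The coordinate expression equals \<open>V r (x r)\<close> only while the
    solution is in the chart; near \<open>t\<close> these are all the times in
    \<open>{s..u}\<close>.\<close>
  let ?J = "{r\<in>{s..u}. x r \<in> cdom c}"
  have J: "at t within {s..u} = at t within ?J"
  proof -
    obtain U where U: "open U" "U \<inter> {s..u} = x -` cdom c \<inter> {s..u}"
      using cont open_cdom[OF c(1)] continuous_on_open_invariant by metis
    show ?thesis
    proof (rule at_within_nhd)
      show "t \<in> U" "open U" "{s..u} \<inter> U - {t} = ?J \<inter> U - {t}" using U t c by blast+
    qed
  qed
  have "((coord c \<circ> x) has_vector_derivative ?w) (at t within {s..u})"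
    using x t cx by (simp add: solution_on_def has_velocity_def)
  then have "((coord c \<circ> x) has_derivative (\<lambda>h. h *\<^sub>R ?w)) (at t within ?J)"
    by (simp only: has_vector_derivative_def J)
  then have P: "((\<lambda>r. (r, coord c (x r))) has_derivative (\<lambda>h. (h, h *\<^sub>R ?w))) (at t within ?J)"
    by (intro has_derivative_Pair has_derivative_ident) (simp add: o_def)
  have "(?H has_derivative ?F) (at (t, ?y) within (\<lambda>r. (r, coord c (x r))) ` ?J)"
    by (rule has_derivative_subset[OF H]) (use s xD in auto)
  with P have "((?H \<circ> (\<lambda>r. (r, coord c (x r)))) has_derivative (?F \<circ> (\<lambda>h. (h, h *\<^sub>R ?w)))) (at t within ?J)"
    by (rule diff_chain_within)
  moreover have "?F \<circ> (\<lambda>h. (h, h *\<^sub>R ?w)) = (*) (?F (1, 0) + ?F (0, ?w))"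
  proof
    fix h
    have "?F (h, h *\<^sub>R ?w) = ?F (h *\<^sub>R ((1, 0) + (0, ?w)))" by simp
    also have "\<dots> = h *\<^sub>R (?F (1, 0) + ?F (0, ?w))"
      by (simp only: linear_scale[OF lin] linear_add[OF lin])
    finally show "(?F \<circ> (\<lambda>h. (h, h *\<^sub>R ?w))) h = (?F (1, 0) + ?F (0, ?w)) * h" by (simp add: mult.commute)
  qed
  ultimately have "((?H \<circ> (\<lambda>r. (r, coord c (x r)))) has_derivative (*) (?F (1, 0) + ?F (0, ?w)))
      (at t within ?J)" by simp
  then have "((\<lambda>r. V r (x r)) has_derivative (*) (?F (1, 0) + ?F (0, ?w))) (at t within ?J)"
    by (rule has_derivative_transform[rotated 2]) (use t c in auto)
  then show ?thesis
    unfolding J td df has_field_derivative_def .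
qed

end

text \<open>A Gronwall argument: multiplied by the integrating factor exp(k t), the function becomes
  nonincreasing.\<close>

lemma exponential_decay:
  fixes h h' :: "real \<Rightarrow> real"
  assumes "s \<le> u" and h: "\<And>t. t \<in> {s..u} \<Longrightarrow> (h has_real_derivative h' t) (at t within {s..u})"
    and le: "\<And>t. t \<in> {s..u} \<Longrightarrow> h' t \<le> - k * h t"
  shows "h u \<le> h s * exp (- k * (u - s))"
proof -
  let ?\<phi> = "\<lambda>t. h t * exp (k * t)"
  have d: "(?\<phi> has_real_derivative (h' t + k * h t) * exp (k * t)) (at t within {s..u})"
    if "t \<in> {s..u}" for t
    by (auto intro!: derivative_eq_intros h that simp: algebra_simps)
  have "?\<phi> u \<le> ?\<phi> s"
  proof (rule DERIV_nonpos_imp_decreasing_open[OF \<open>s \<le> u\<close>])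
    fix t assume t: "s < t" "t < u"
    have "(?\<phi> has_real_derivative (h' t + k * h t) * exp (k * t)) (at t)"
      using d[of t] t by (simp add: at_within_Icc_at)
    moreover have "(h' t + k * h t) * exp (k * t) \<le> 0"
      using le[of t] t by (intro mult_nonpos_nonneg) auto
    ultimately show "\<exists>y. (?\<phi> has_real_derivative y) (at t) \<and> y \<le> 0" by blast
  next
    show "continuous_on {s..u} ?\<phi>" by (rule DERIV_continuous_on[OF d])
  qed
  then have "h u \<le> h s * exp (k * s) / exp (k * u)" by (simp add: field_simps)
  also have "\<dots> = h s * exp (- k * (u - s))"
    by (simp add: exp_diff right_diff_distrib)
  finally show ?thesis .
qed

section \<open>Consequences of the Lyapunov inequalities\<close>

context connected_riemannian begin

context
  fixes D :: "'m set" and f :: "real \<Rightarrow> 'm \<Rightarrow> ('m, 'n) tvec" and V :: "real \<Rightarrow> 'm \<Rightarrow> real"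
    and p :: 'm and k\<^sub>1 k\<^sub>2 k\<^sub>3 a :: real
  assumes D: "open D" and V: "C1_time_function A D V"
    and k: "0 < k\<^sub>1" "0 < k\<^sub>2" "0 < k\<^sub>3" "0 < a"
    and bounds: "\<forall>t\<ge>0. \<forall>x\<in>D. k\<^sub>1 * rdist A g p x powr a \<le> V t x \<and> V t x \<le> k\<^sub>2 * rdist A g p x powr a"
    and decrease: "\<forall>t\<ge>0. \<forall>x\<in>D. time_deriv V t x + differential A (V t) x (f t x)
           \<le> - k\<^sub>3 * rdist A g p x powr a"
begin

text \<open>The upper bound on \<open>V\<close> converts the decrease by k3 \<rho>^a into a decrease
  by (k3/k2) \<open>V\<close>, a linear differential inequality.\<close>

lemma lyapunov_decay:
  assumes x: "solution_on D f s u x" and "0 \<le> s" "s \<le> u"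
  shows "V u (x u) \<le> V s (x s) * exp (- (k\<^sub>3 / k\<^sub>2) * (u - s))"
proof (rule exponential_decay[OF \<open>s \<le> u\<close>])
  fix t assume t: "t \<in> {s..u}"
  show "((\<lambda>t. V t (x t)) has_real_derivative
      time_deriv V t (x t) + differential A (V t) (x t) (f t (x t))) (at t within {s..u})"
    by (rule lyapunov_chain_rule[OF V D x \<open>0 \<le> s\<close> t])
  have xt: "x t \<in> D" "0 \<le> t" using x t \<open>0 \<le> s\<close> by (auto simp: solution_on_def)
  have "(k\<^sub>3 / k\<^sub>2) * V t (x t) \<le> (k\<^sub>3 / k\<^sub>2) * (k\<^sub>2 * rdist A g p (x t) powr a)"
    using bounds xt k by (intro mult_left_mono) auto
  also have "\<dots> = k\<^sub>3 * rdist A g p (x t) powr a" using k by simp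
  finally show "time_deriv V t (x t) + differential A (V t) (x t) (f t (x t)) \<le> - (k\<^sub>3 / k\<^sub>2) * V t (x t)"
    using decrease xt by fastforce
qed

lemma lyapunov_nonincreasing:
  assumes x: "solution_on D f s u x" and "0 \<le> s" "s \<le> u"
  shows "V u (x u) \<le> V s (x s)"
proof -
  have "x s \<in> D" using x \<open>s \<le> u\<close> by (simp add: solution_on_def)
  then have "0 \<le> V s (x s)"
    using bounds \<open>0 \<le> s\<close> k order_trans[of 0 "k\<^sub>1 * rdist A g p (x s) powr a" "V s (x s)"] by simp
  moreover have "exp (- (k\<^sub>3 / k\<^sub>2) * (u - s)) \<le> 1" using k \<open>s \<le> u\<close> by simp
  ultimately have "V s (x s) * exp (- (k\<^sub>3 / k\<^sub>2) * (u - s)) \<le> V s (x s)"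
    by (rule mult_left_le[rotated])
  then show ?thesis using lyapunov_decay[OF assms] by linarith
qed

text \<open>The lower bound on \<open>V\<close> at time \<open>u\<close> and the upper bound at time
  \<open>s\<close> enclose the decay of \<open>V\<close>; taking the a-th root divides the rate by
  \<open>a\<close>.\<close>

lemma rdist_decay:
  assumes x: "solution_on D f s u x" and "0 \<le> s" "s \<le> u"
  shows "rdist A g p (x u) \<le> (k\<^sub>2 / k\<^sub>1) powr (1 / a) * rdist A g p (x s) * exp (- (k\<^sub>3 / (a * k\<^sub>2)) * (u - s))"
proof -
  let ?\<rho> = "\<lambda>t. rdist A g p (x t)"
  let ?e = "exp (- (k\<^sub>3 / k\<^sub>2) * (u - s))"
  have xD: "x s \<in> D" "x u \<in> D" using x \<open>s \<le> u\<close> by (auto simp: solution_on_def)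
  have "k\<^sub>1 * ?\<rho> u powr a \<le> V u (x u)" using bounds xD assms by simp
  also have "\<dots> \<le> V s (x s) * ?e" by (rule lyapunov_decay[OF assms])
  also have "\<dots> \<le> k\<^sub>2 * ?\<rho> s powr a * ?e" using bounds xD assms by (intro mult_right_mono) auto
  finally have "?\<rho> u powr a \<le> (k\<^sub>2 / k\<^sub>1) * ?\<rho> s powr a * ?e"
    using k by (simp add: field_simps)
  then have "(?\<rho> u powr a) powr (1 / a) \<le> ((k\<^sub>2 / k\<^sub>1) * ?\<rho> s powr a * ?e) powr (1 / a)"
    using k by (intro powr_mono2) auto
  moreover have "(?\<rho> t powr a) powr (1 / a) = ?\<rho> t" for t
    using k rdist_nonneg by (simp add: powr_powr)
  moreover have "?e powr (1 / a) = exp (- (k\<^sub>3 / (a * k\<^sub>2)) * (u - s))"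
    using k by (simp add: exp_powr_real)
  ultimately show ?thesis by (simp only: powr_mult)
qed

lemma sublevel_existence:
  assumes f: "time_vector_field A D f" "continuous_in_time A D f" "locally_lipschitz_in_space A D f"
    and complete: "rdist.mcomplete"
    and R: "{y. rdist A g p y \<le> R} \<subseteq> D" "0 \<le> R"
    and s: "0 \<le> s" and q: "q \<in> D" "V s q \<le> k\<^sub>1 * R powr a"
  shows "\<exists>x. x s = q \<and> solution_from A D f s x"
\<comment> \<open>Membership in \<open>D\<close> is part of the invariant set because the bounds on
  \<open>V\<close> hold only there.\<close>
proof (rule global_existence[OF f compact_closed_ball[OF complete] R(1),
      where Q = "\<lambda>t. {q\<in>D. V t q \<le> k\<^sub>1 * R powr a}"])
  fix t :: real assume t: "0 \<le> t"
  show "{q\<in>D. V t q \<le> k\<^sub>1 * R powr a} \<subseteq> {y. rdist A g p y \<le> R}"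
  proof safe
    fix q assume "q \<in> D" "V t q \<le> k\<^sub>1 * R powr a"
    then have "k\<^sub>1 * rdist A g p q powr a \<le> k\<^sub>1 * R powr a" using bounds t order_trans by blast
    then have "rdist A g p q powr a \<le> R powr a" using k by simp
    then show "rdist A g p q \<le> R" using powr_less_mono2[OF k(4) R(2)] by (meson not_le)
  qed
next
  fix t u x
  assume "0 \<le> t" "t \<le> u" and x: "solution_on D f t u x" "x t \<in> {q\<in>D. V t q \<le> k\<^sub>1 * R powr a}"
  then show "x u \<in> {q\<in>D. V u q \<le> k\<^sub>1 * R powr a}"
    using lyapunov_nonincreasing[OF x(1)] by (auto simp: solution_on_def)
qed (use s q in auto)

end

text \<open>The dimension is at least 1: a chart would carry an open singleton to an open singleton
  of \<open>real^'n\<close>. The second point provides a nonzero distance for comparing k1 with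
  k2.\<close>

lemma open_not_singleton:
  fixes p :: 'm
  assumes "open D" "p \<in> D"
  shows "\<exists>q\<in>D. q \<noteq> p"
proof (rule ccontr)
  assume "\<not> (\<exists>q\<in>D. q \<noteq> p)"
  then have D: "D = {p}" using assms by blast
  obtain c where c: "c \<in> A" "p \<in> cdom c" using chart_exists by blast
  have "open (coord c ` {p})"
    using assms D c by (intro open_coord_image) auto
  then show False by (simp add: not_open_singleton)
qed

end

theorem theorem2p2:
  fixes A :: "('m::{t2_space, second_countable_topology}, 'n::finite) chart set"
    and g :: "('m, 'n) metric_tensor"
    and x\<^sub>e :: 'm and D :: "'m set"
    and f :: "real \<Rightarrow> 'm \<Rightarrow> ('m, 'n) tvec"
    and r\<^sub>0 :: ereal
    and V :: "real \<Rightarrow> 'm \<Rightarrow> real"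
    and k\<^sub>1 k\<^sub>2 k\<^sub>3 a :: real
  assumes "complete_riemannian_manifold A g"
    and "open D" and "x\<^sub>e \<in> D" and "D \<subseteq> rball A g x\<^sub>e (injectivity_radius A g x\<^sub>e)"
    and "time_vector_field A D f"
    and "continuous_in_time A D f"
    and "locally_lipschitz_in_space A D f"
    and "\<forall>t\<ge>0. f t x\<^sub>e = (\<lambda>c. 0)"
    and "r\<^sub>0 = Sup {ereal r | r. 0 < r \<and> rball A g x\<^sub>e (ereal r) \<subseteq> D}"
    and "C1_time_function A D V"
    and "0 < k\<^sub>1" and "0 < k\<^sub>2" and "0 < k\<^sub>3" and "0 < a"
    and "\<forall>t\<ge>0. \<forall>x\<in>D. k\<^sub>1 * rdist A g x\<^sub>e x powr a \<le> V t x \<and> V t x \<le> k\<^sub>2 * rdist A g x\<^sub>e x powr a"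
    and "\<forall>t\<ge>0. \<forall>x\<in>D. time_deriv V t x + differential A (V t) x (f t x)
           \<le> - k\<^sub>3 * rdist A g x\<^sub>e x powr a"
  shows "exponentially_stable_in A g D f x\<^sub>e
           (rball A g x\<^sub>e (ereal ((k\<^sub>1 / k\<^sub>2) powr (1 / a)) * r\<^sub>0)) \<and>
         (\<forall>t0\<ge>0. \<forall>x. solution_from A D f t0 x \<and>
            x t0 \<in> rball A g x\<^sub>e (ereal ((k\<^sub>1 / k\<^sub>2) powr (1 / a)) * r\<^sub>0) \<longrightarrow>
            (\<forall>t\<ge>t0. rdist A g (x t) x\<^sub>e
               \<le> (k\<^sub>2 / k\<^sub>1) powr (1 / a) * rdist A g (x t0) x\<^sub>e
                   * exp (- (k\<^sub>3 / (a * k\<^sub>2)) * (t - t0))))"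
proof -
  note D = assms(2) and V = assms(10) and k = assms(11-14) and bounds = assms(15) and decrease = assms(16)
  have complete: "Metric_space.mcomplete UNIV (rdist A g)"
    using assms(1) by (simp add: complete_riemannian_manifold_def)
  interpret connected_riemannian A g
    using assms(1) by unfold_locales (simp_all add: complete_riemannian_manifold_def)
  let ?c = "(k\<^sub>1 / k\<^sub>2) powr (1 / a)"
  let ?D = "rball A g x\<^sub>e (ereal ?c * r\<^sub>0)"
  have c0: "0 < ?c" using k by simp
  have ca: "?c powr a = k\<^sub>1 / k\<^sub>2" using k by (simp add: powr_powr)
  \<comment> \<open>At a point of \<open>D\<close> away from the equilibrium the two bounds on
    \<open>V\<close> can be divided by a positive power of the distance. The resulting factor
    \<open>?c \<le> 1\<close> keeps the ball of admissible initial points inside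
    \<open>D\<close>.\<close>
  have "k\<^sub>1 \<le> k\<^sub>2"
  proof -
    obtain q where q: "q \<in> D" "q \<noteq> x\<^sub>e" using open_not_singleton[OF assms(2,3)] by blast
    then have "0 < rdist A g x\<^sub>e q" using rdist_nonneg[of x\<^sub>e q] rdist_eq_0[of x\<^sub>e q] by force
    moreover have "k\<^sub>1 * rdist A g x\<^sub>e q powr a \<le> k\<^sub>2 * rdist A g x\<^sub>e q powr a"
      using bounds q(1) order_trans by blast
    ultimately show ?thesis by simp
  qed
  then have c1: "?c \<le> 1" using k by (simp add: powr_le1)
  have radius: "{y. rdist A g x\<^sub>e y \<le> rdist A g x\<^sub>e q / ?c} \<subseteq> D" if q: "q \<in> ?D" for q
  proof -
    have "ereal (rdist A g x\<^sub>e q) < ereal ?c * r\<^sub>0" using q by (simp add: rball_def)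
    then have "ereal (rdist A g x\<^sub>e q / ?c) < r\<^sub>0"
      using c0 by (cases r\<^sub>0) (auto simp: field_simps)
    then obtain r where "rball A g x\<^sub>e (ereal r) \<subseteq> D" "rdist A g x\<^sub>e q / ?c < r"
      unfolding assms(9) less_Sup_iff by auto
    then show ?thesis by (auto simp: rball_def)
  qed
  have sub: "q \<in> D" if "q \<in> ?D" for q
  proof -
    have "rdist A g x\<^sub>e q * ?c \<le> rdist A g x\<^sub>e q * 1"
      by (rule mult_left_mono[OF c1 rdist_nonneg])
    then have "rdist A g x\<^sub>e q \<le> rdist A g x\<^sub>e q / ?c" using c0 by (simp add: pos_le_divide_eq)
    then show ?thesis using radius[OF that] by blast
  qed
  have existence: "\<exists>x. solution_from A D f t0 x \<and> x t0 = q" if "0 \<le> t0" and q: "q \<in> ?D" for t0 q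
  proof -
    \<comment> \<open>The radius at which k1 R^a equals k2 \<rho>^a, so that \<open>q\<close> starts
      in the sublevel set belonging to \<open>?R\<close>.\<close>
    let ?R = "rdist A g x\<^sub>e q / ?c"
    have "?R powr a = rdist A g x\<^sub>e q powr a / (k\<^sub>1 / k\<^sub>2)"
      by (simp only: powr_divide[of _ ?c] ca)
    then have R: "k\<^sub>2 * rdist A g x\<^sub>e q powr a = k\<^sub>1 * ?R powr a" using k by simp
    have "V t0 q \<le> k\<^sub>2 * rdist A g x\<^sub>e q powr a" using bounds \<open>0 \<le> t0\<close> sub[OF q] by blast
    also note R
    finally show ?thesis
      using sublevel_existence[OF D V k bounds decrease assms(5-7) complete radius[OF q] _ \<open>0 \<le> t0\<close> sub[OF q]]
        c0 rdist_nonneg by auto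
  qed
  have decay: "rdist A g x\<^sub>e (x t) \<le> (k\<^sub>2 / k\<^sub>1) powr (1 / a) * rdist A g x\<^sub>e (x t0)
      * exp (- (k\<^sub>3 / (a * k\<^sub>2)) * (t - t0))"
    if "0 \<le> t0" "solution_from A D f t0 x" "t0 \<le> t" for t0 t x
    using rdist_decay[OF D V k bounds decrease solution_from_imp_solution_on[OF that(2)] that(1,3)] .
  have subset: "?D \<subseteq> D" using sub by blast
  have pos: "0 < (k\<^sub>2 / k\<^sub>1) powr (1 / a)" "0 < k\<^sub>3 / (a * k\<^sub>2)" using k by simp_all
  have "exponentially_stable_in A g D f x\<^sub>e ?D"
    unfolding exponentially_stable_in_def
    by (rule conjI[OF subset], rule exI, rule conjI[OF pos(1)], rule exI, rule conjI[OF pos(2)])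
       (intro allI ballI impI conjI existence decay; simp)
  moreover have "\<forall>t\<ge>t0. rdist A g (x t) x\<^sub>e \<le> (k\<^sub>2 / k\<^sub>1) powr (1 / a) * rdist A g (x t0) x\<^sub>e
      * exp (- (k\<^sub>3 / (a * k\<^sub>2)) * (t - t0))"
    if "0 \<le> t0" "solution_from A D f t0 x" for t0 x
  proof (intro allI impI)
    fix t assume "t0 \<le> t"
    from decay[OF that this] show "rdist A g (x t) x\<^sub>e \<le> (k\<^sub>2 / k\<^sub>1) powr (1 / a) * rdist A g (x t0) x\<^sub>e
        * exp (- (k\<^sub>3 / (a * k\<^sub>2)) * (t - t0))"
      by (simp only: rdist_commute[of _ x\<^sub>e])
  qed
  ultimately show ?thesis by blast
qed

end
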